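(* Let $m\ge2$ be an integer, let $\ell_m$ be the nowhere-vanishing null vector field on $\mathrm{AdS}_3=\mathrm{SU}(1,1)$ and $f_m\colon\mathrm{SU}(1,1)\to\mathrm{SU}(1,1)$ the smooth map defined in the context. Then for every $\epsilon\in\{+1,-1\}$ the spinor $$\psi_{m,\epsilon}(q)=[(q,\mathbf 1),f_m(q)\mathbb 1_\epsilon]$$ is an $\epsilon$-unit generalized Killing spinor on $\mathrm{AdS}_3$. The two causal types ($\epsilon=\pm1$) have the same symmetric endomorphism $A_m\in\Gamma(\mathrm{End}(T\mathrm{AdS}_3))$, that is $\nabla_{\mathcal X}\psi_{m,\epsilon}=\sqrt{-1}\,A_m(\mathcal X)\cdot\psi_{m,\epsilon}$, given by $$A_m=\tfrac12\,\mathrm{id}-\tfrac19\,\ell_m\otimes\ell_m^\flat,\qquad \ell_m^\flat=g(\ell_m,\cdot).$$ In particular, if $N_m:=A_m-\frac12\mathrm{id}$, then for every $q\in\mathrm{AdS}_3$: $N_m|_q\ne0$, $\operatorname{rank}N_m|_q=1$ and $(N_m|_q)^2=0$. Consequently $A_m$ is not diagonalizable at any point $q\in\mathrm{AdS}_3$.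
   Context: Algebra (Lorentzian case). $\mathfrak m=(\mathbb R^{1,2},\langle\cdot,\cdot\rangle)$ is oriented with oriented orthonormal basis $X_0,X_1,X_2$, $\langle X_0,X_0\rangle=-1$, $\langle X_1,X_1\rangle=\langle X_2,X_2\rangle=1$; $H=\mathrm{SU}(1,1)$ with Lie algebra $\mathfrak h$. $\gamma_0=\mathrm{diag}(1,-1)$, $\gamma_1=\begin{pmatrix}0&1\\-1&0\end{pmatrix}$, $\gamma_2=\begin{pmatrix}0&\sqrt{-1}\\ \sqrt{-1}&0\end{pmatrix}$; $\gamma\colon\mathfrak m\to\mathfrak{gl}(2,\mathbb C)$ is linear with $\gamma(X_k)=\gamma_k$. $\lambda\colon H\to\mathrm{SO}_0(\mathfrak m)$ is the double covering with $\gamma(\lambda(h)X)=h\gamma(X)h^{-1}$. $l_g\colon\mathfrak m\to\mathfrak h$ is the linear isomorphism $l_g(X)=\frac{\sqrt{-1}}2\gamma(X)$. Space. $\mathrm{AdS}_3=H$ carries the bi-invariant metric $g$ of constant sectional curvature $-1$: $g_q(2q\,l_g(X),2q\,l_g(Y))=\langle X,Y\rangle$. Its principal spin bundle is $P=H\times H$ with $\pi(g_L,g_R)=g_Lg_R^\dagger$, right $H$-action $(g_L,g_R)\cdot h=(g_Lh,g_R(h^{-1})^\dagger)$, solder form $\theta=l_g^{-1}\frac{\omega^L+(\omega^R)^\dagger}{2}$ and spin Levi-Civita connection form $\widetilde\omega=\frac{\omega^L-(\omega^R)^\dagger}{2}$, where $\omega^L,\omega^R$ are the (left-invariant) Maurer–Cartan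 forms of the factors. For $u\in P$, $X\in\mathfrak m$, $[u,X]\in T_{\pi(u)}\mathrm{AdS}_3$ is $d\pi(\xi)$ for any $\xi\in T_uP$ with $\theta(\xi)=X$; in particular $[(q,\mathbf 1),X]=2q\,l_g(X)\in T_q\mathrm{AdS}_3$. Spinors. $\Sigma\,\mathrm{AdS}_3=P\times_H\mathbb C^2$ (defining representation); $[u,X]\cdot[u,v]=[u,\gamma(X)v]$; $\langle\psi,\phi\rangle=\psi^\dagger\gamma_0\phi$; $\nabla_{\mathcal X}[s,v]=[s,dv(\mathcal X)+(s^*\widetilde\omega)(\mathcal X)v]$ for a section $s$ of $P$. $\psi$ is $\epsilon$-unit if $\langle\psi,\psi\rangle=\epsilon$; it is then a generalized Killing spinor if the unique real $(1,1)$-tensor field $A$ with $\nabla_{\mathcal X}\psi=\sqrt{-1}A(\mathcal X)\cdot\psi$ for all $\mathcal X$ is $g$-symmetric. $\mathbb 1_{+1}=(1,0)^T$, $\mathbb 1_{-1}=(0,1)^T$. Construction of $f_m,\ell_m$. Put $\ell=X_1-X_0$, $\omega_m=\sqrt{2/(m^2-1)}$, $Y_m=-\frac{\omega_m^2+11}{6}X_0+\frac{\omega_m^2-7}{6}X_1$, $Z_m=-\frac{\omega_m^2+9}{6}X_0+\frac{\omega_m^2-9}{6}X_1$, $T_m=2\pi/\omega_m$. For $u,w,v\in\mathbb R$ let $a(u,w)=\exp(u\,l_g(\ell))\exp(-2w\,l_g(X_2))$, $b_m(v)=\exp(2v\,l_g(Y_m))$, $k_m(v)=\exp(2v\,l_g(Z_m))$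 in $\mathrm{SU}(1,1)$. Both $b_m$ and $k_m$ are $T_m$-periodic, and $\mathbb R^2\times\mathbb R/T_m\mathbb Z\ni(w,u,[v])\mapsto a(u,w)k_m(v)^{-1}\in\mathrm{SU}(1,1)$ is a diffeomorphism. Writing $q=a(u,w)k_m(v)^{-1}$, define $f_m(q)=k_m(v)b_m(v)^{-1}$ and $\ell_m|_q=[(q,\mathbf 1),\lambda(k_m(v))\ell]$. *)

theory Defs
  imports "HOL-Analysis.Analysis"
begin

section \<open>Smooth maps on subsets of Euclidean spaces\<close>

(* On an open set U of a Euclidean space this is the usual class C^k: all iterated
   directional derivatives up to order k exist and are continuous. *)
primrec Ck_on :: "nat \<Rightarrow> ('a::euclidean_space \<Rightarrow> 'b::real_normed_vector) \<Rightarrow> 'a set \<Rightarrow> bool" where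
  "Ck_on 0 f U \<longleftrightarrow> continuous_on U f"
| "Ck_on (Suc k) f U \<longleftrightarrow>
     (\<forall>x\<in>U. f differentiable (at x)) \<and> (\<forall>v. Ck_on k (\<lambda>x. frechet_derivative f (at x) v) U)"

(* Smoothness of a map defined on an arbitrary subset: locally the restriction of a smooth map
   on an open set. For an embedded submanifold this is smoothness in the sense of manifolds. *)
definition smooth_on :: "'a::euclidean_space set \<Rightarrow> ('a \<Rightarrow> 'b::real_normed_vector) \<Rightarrow> bool" where
  "smooth_on S f \<longleftrightarrow>
     (\<forall>x\<in>S. \<exists>U F. open U \<and> x \<in> U \<and> (\<forall>k. Ck_on k F U) \<and> (\<forall>y\<in>S \<inter> U. f y = F y))"

section \<open>Algebra\<close>

type_synonym cmat = "complex^2^2"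
type_synonym spinor = "complex^2"

(* The coordinates 1, 2, 3 of real^3 belong to the basis vectors X0, X1, X2. *)
type_synonym mvec = "real^3"

definition X0 :: mvec where "X0 = axis 1 1"
definition X1 :: mvec where "X1 = axis 2 1"
definition X2 :: mvec where "X2 = axis 3 1"

definition mink :: "mvec \<Rightarrow> mvec \<Rightarrow> real" where
  "mink X Y = - (X$1 * Y$1) + X$2 * Y$2 + X$3 * Y$3"

definition dagger :: "cmat \<Rightarrow> cmat" where
  "dagger M = (\<chi> i j. cnj (M $ j $ i))"

(* HOL-Analysis has no exponential for the matrix product: times on this type is componentwise. *)
definition mexp :: "cmat \<Rightarrow> cmat" where
  "mexp M = (\<Sum>n. (1 / fact n) *\<^sub>R (((\<lambda>B. M ** B) ^^ n) (mat 1)))"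

definition gamma0 :: cmat where
  "gamma0 = vector [vector [1, 0], vector [0, -1]]"
definition gamma1 :: cmat where
  "gamma1 = vector [vector [0, 1], vector [-1, 0]]"
definition gamma2 :: cmat where
  "gamma2 = vector [vector [0, \<i>], vector [\<i>, 0]]"

definition gam :: "mvec \<Rightarrow> cmat" where
  "gam X = (X$1) *\<^sub>R gamma0 + (X$2) *\<^sub>R gamma1 + (X$3) *\<^sub>R gamma2"

definition SU11 :: "cmat set" where
  "SU11 = {h. dagger h ** gamma0 ** h = gamma0 \<and> det h = 1}"

definition su11 :: "cmat set" where
  "su11 = {\<xi>. dagger \<xi> ** gamma0 + gamma0 ** \<xi> = 0 \<and> trace \<xi> = 0}"

definition lam :: "cmat \<Rightarrow> mvec \<Rightarrow> mvec" where
  "lam h X = (THE Y. gam Y = h ** gam X ** matrix_inv h)"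

(* (i/2) gamma(X), with the complex scalar acting entrywise *)
definition lg :: "mvec \<Rightarrow> cmat" where
  "lg X = (\<chi> i j. (\<i> / 2) * (gam X $ i $ j))"

section \<open>Anti-de Sitter space and its spin frame bundle\<close>

abbreviation AdS3 :: "cmat set" where "AdS3 \<equiv> SU11"

definition tangent :: "cmat \<Rightarrow> cmat set" where
  "tangent q = {q ** \<xi> | \<xi>. \<xi> \<in> su11}"

(* lg is injective with image su11, so that inv lg is its inverse on su11. *)
definition ads_metric :: "cmat \<Rightarrow> cmat \<Rightarrow> cmat \<Rightarrow> real" where
  "ads_metric q V W =
     mink (inv lg ((1/2) *\<^sub>R (matrix_inv q ** V))) (inv lg ((1/2) *\<^sub>R (matrix_inv q ** W)))"

definition frames :: "(cmat \<times> cmat) set" where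
  "frames = SU11 \<times> SU11"

definition frame_tangent :: "cmat \<times> cmat \<Rightarrow> (cmat \<times> cmat) set" where
  "frame_tangent u = tangent (fst u) \<times> tangent (snd u)"

definition frame_proj :: "cmat \<times> cmat \<Rightarrow> cmat" where
  "frame_proj u = fst u ** dagger (snd u)"

definition frame_act :: "cmat \<times> cmat \<Rightarrow> cmat \<Rightarrow> cmat \<times> cmat" where
  "frame_act u h = (fst u ** h, snd u ** dagger (matrix_inv h))"

definition omegaL :: "cmat \<times> cmat \<Rightarrow> cmat \<times> cmat \<Rightarrow> cmat" where
  "omegaL u \<xi> = matrix_inv (fst u) ** fst \<xi>"
definition omegaR :: "cmat \<times> cmat \<Rightarrow> cmat \<times> cmat \<Rightarrow> cmat" where
  "omegaR u \<xi> = matrix_inv (snd u) ** snd \<xi>"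

definition solder :: "cmat \<times> cmat \<Rightarrow> cmat \<times> cmat \<Rightarrow> mvec" where
  "solder u \<xi> = inv lg ((1/2) *\<^sub>R (omegaL u \<xi> + dagger (omegaR u \<xi>)))"

definition spin_connection :: "cmat \<times> cmat \<Rightarrow> cmat \<times> cmat \<Rightarrow> cmat" where
  "spin_connection u \<xi> = (1/2) *\<^sub>R (omegaL u \<xi> - dagger (omegaR u \<xi>))"

(* The tangent vector [u,X]. *)
definition frame_vec :: "cmat \<times> cmat \<Rightarrow> mvec \<Rightarrow> cmat" where
  "frame_vec u X = (THE V. \<exists>\<xi>\<in>frame_tangent u.
     solder u \<xi> = X \<and> V = frechet_derivative frame_proj (at u) \<xi>)"

section \<open>Spinors\<close>

(* Points of the spinor bundle are the equivalence classes [u,v], with u in frames. *)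
type_synonym spinor_class = "((cmat \<times> cmat) \<times> spinor) set"

definition spin_class :: "cmat \<times> cmat \<Rightarrow> spinor \<Rightarrow> spinor_class" where
  "spin_class u v = {(frame_act u h, matrix_inv h *v v) | h. h \<in> SU11}"

definition clifford :: "cmat \<Rightarrow> spinor_class \<Rightarrow> spinor_class" where
  "clifford V \<Psi> = (THE \<Phi>. \<exists>u\<in>frames. \<exists>X v.
     V = frame_vec u X \<and> \<Psi> = spin_class u v \<and> \<Phi> = spin_class u (gam X *v v))"

definition spin_scale :: "complex \<Rightarrow> spinor_class \<Rightarrow> spinor_class" where
  "spin_scale c \<Psi> = (THE \<Phi>. \<exists>u\<in>frames. \<exists>v.
     \<Psi> = spin_class u v \<and> \<Phi> = spin_class u (c *s v))"

definition spin_inner :: "spinor_class \<Rightarrow> spinor_class \<Rightarrow> complex" where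
  "spin_inner \<Psi> \<Phi> = (THE c. \<exists>u\<in>frames. \<exists>v w.
     \<Psi> = spin_class u v \<and> \<Phi> = spin_class u w \<and>
     c = (\<Sum>i\<in>UNIV. cnj (v $ i) * (gamma0 *v w) $ i))"

definition smooth_frame :: "(cmat \<Rightarrow> cmat \<times> cmat) \<Rightarrow> bool" where
  "smooth_frame s \<longleftrightarrow> smooth_on AdS3 s \<and> (\<forall>q\<in>AdS3. s q \<in> frames \<and> frame_proj (s q) = q)"

(* The frame bundle has the global smooth section q \<mapsto> (q, 1), so that global sections suffice. *)
definition represents :: "(cmat \<Rightarrow> spinor_class) \<Rightarrow> (cmat \<Rightarrow> cmat \<times> cmat) \<Rightarrow> (cmat \<Rightarrow> spinor) \<Rightarrow> bool" where
  "represents \<psi> s v \<longleftrightarrow>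
     smooth_frame s \<and> smooth_on AdS3 v \<and> (\<forall>q\<in>AdS3. \<psi> q = spin_class (s q) (v q))"

definition spinor_field :: "(cmat \<Rightarrow> spinor_class) \<Rightarrow> bool" where
  "spinor_field \<psi> \<longleftrightarrow> (\<exists>s v. represents \<psi> s v)"

(* frechet_derivative within AdS3 is determined only on vectors tangent to AdS3; nabla is
   meant for X in tangent q. *)
definition nabla :: "(cmat \<Rightarrow> spinor_class) \<Rightarrow> cmat \<Rightarrow> cmat \<Rightarrow> spinor_class" where
  "nabla \<psi> q X = (THE \<Phi>. \<exists>s v. represents \<psi> s v \<and>
     \<Phi> = spin_class (s q)
       (frechet_derivative v (at q within AdS3) X
        + spin_connection (s q) (frechet_derivative s (at q within AdS3) X) *v v q))"

section \<open>Generalized Killing spinors\<close>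

definition smooth_vector_field :: "(cmat \<Rightarrow> cmat) \<Rightarrow> bool" where
  "smooth_vector_field V \<longleftrightarrow> smooth_on AdS3 V \<and> (\<forall>q\<in>AdS3. V q \<in> tangent q)"

(* Smooth sections of End(TAdS3), i.e. real (1,1)-tensor fields. Only the values A q X with q in
   AdS3 and X in tangent q are meaningful. *)
definition endomorphism_field :: "(cmat \<Rightarrow> cmat \<Rightarrow> cmat) \<Rightarrow> bool" where
  "endomorphism_field A \<longleftrightarrow>
     (\<forall>q\<in>AdS3. (\<forall>X\<in>tangent q. A q X \<in> tangent q) \<and>
        (\<forall>X\<in>tangent q. \<forall>Y\<in>tangent q. A q (X + Y) = A q X + A q Y) \<and>
        (\<forall>X\<in>tangent q. \<forall>c::real. A q (c *\<^sub>R X) = c *\<^sub>R A q X)) \<and>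
     (\<forall>V. smooth_vector_field V \<longrightarrow> smooth_vector_field (\<lambda>q. A q (V q)))"

definition g_symmetric :: "(cmat \<Rightarrow> cmat \<Rightarrow> cmat) \<Rightarrow> bool" where
  "g_symmetric A \<longleftrightarrow> (\<forall>q\<in>AdS3. \<forall>X\<in>tangent q. \<forall>Y\<in>tangent q.
     ads_metric q (A q X) Y = ads_metric q X (A q Y))"

definition killing_endomorphism :: "(cmat \<Rightarrow> spinor_class) \<Rightarrow> (cmat \<Rightarrow> cmat \<Rightarrow> cmat) \<Rightarrow> bool" where
  "killing_endomorphism \<psi> A \<longleftrightarrow> endomorphism_field A \<and>
     (\<forall>q\<in>AdS3. \<forall>X\<in>tangent q. nabla \<psi> q X = spin_scale \<i> (clifford (A q X) (\<psi> q)))"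

definition unit_spinor_field :: "real \<Rightarrow> (cmat \<Rightarrow> spinor_class) \<Rightarrow> bool" where
  "unit_spinor_field \<epsilon> \<psi> \<longleftrightarrow>
     spinor_field \<psi> \<and> (\<forall>q\<in>AdS3. spin_inner (\<psi> q) (\<psi> q) = complex_of_real \<epsilon>)"

definition generalized_Killing_spinor :: "real \<Rightarrow> (cmat \<Rightarrow> spinor_class) \<Rightarrow> bool" where
  "generalized_Killing_spinor \<epsilon> \<psi> \<longleftrightarrow> unit_spinor_field \<epsilon> \<psi> \<and>
     (\<exists>A. killing_endomorphism \<psi> A \<and>
          (\<forall>B. killing_endomorphism \<psi> B \<longrightarrow> (\<forall>q\<in>AdS3. \<forall>X\<in>tangent q. B q X = A q X)) \<and>
          g_symmetric A)"

definition unit_vec :: "real \<Rightarrow> spinor" where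
  "unit_vec \<epsilon> = (if \<epsilon> = 1 then vector [1, 0] else vector [0, 1])"

section \<open>The family of examples\<close>

definition ell :: mvec where "ell = X1 - X0"

definition om :: "nat \<Rightarrow> real" where
  "om m = sqrt (2 / ((real m)\<^sup>2 - 1))"

definition Ym :: "nat \<Rightarrow> mvec" where
  "Ym m = (- (((om m)\<^sup>2 + 11) / 6)) *\<^sub>R X0 + (((om m)\<^sup>2 - 7) / 6) *\<^sub>R X1"

definition Zm :: "nat \<Rightarrow> mvec" where
  "Zm m = (- (((om m)\<^sup>2 + 9) / 6)) *\<^sub>R X0 + (((om m)\<^sup>2 - 9) / 6) *\<^sub>R X1"

definition aa :: "real \<Rightarrow> real \<Rightarrow> cmat" where
  "aa u w = mexp (u *\<^sub>R lg ell) ** mexp ((- 2 * w) *\<^sub>R lg X2)"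

definition bm :: "nat \<Rightarrow> real \<Rightarrow> cmat" where
  "bm m v = mexp ((2 * v) *\<^sub>R lg (Ym m))"

definition km :: "nat \<Rightarrow> real \<Rightarrow> cmat" where
  "km m v = mexp ((2 * v) *\<^sub>R lg (Zm m))"

(* Every q in SU11 is aa u w ** matrix_inv (km m v) with unique u, w and with v unique modulo
   2 pi / om m, a common period of bm m and km m. *)
definition fm :: "nat \<Rightarrow> cmat \<Rightarrow> cmat" where
  "fm m q = (THE F. \<exists>u w v. q = aa u w ** matrix_inv (km m v) \<and>
     F = km m v ** matrix_inv (bm m v))"

definition ellm :: "nat \<Rightarrow> cmat \<Rightarrow> cmat" where
  "ellm m q = (THE V. \<exists>u w v. q = aa u w ** matrix_inv (km m v) \<and>
     V = frame_vec (q, mat 1) (lam (km m v) ell))"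

definition psi :: "nat \<Rightarrow> real \<Rightarrow> cmat \<Rightarrow> spinor_class" where
  "psi m \<epsilon> q = spin_class (q, mat 1) (fm m q *v unit_vec \<epsilon>)"

definition Am :: "nat \<Rightarrow> cmat \<Rightarrow> cmat \<Rightarrow> cmat" where
  "Am m q X = (1/2) *\<^sub>R X - (1/9) *\<^sub>R (ads_metric q (ellm m q) X *\<^sub>R ellm m q)"

definition Nm :: "nat \<Rightarrow> cmat \<Rightarrow> cmat \<Rightarrow> cmat" where
  "Nm m q X = Am m q X - (1/2) *\<^sub>R X"

definition diagonalizable_on :: "'a::real_vector set \<Rightarrow> ('a \<Rightarrow> 'a) \<Rightarrow> bool" where
  "diagonalizable_on V L \<longleftrightarrow>
     (\<exists>B\<subseteq>V. independent B \<and> span B = V \<and> (\<forall>x\<in>B. \<exists>c::real. L x = c *\<^sub>R x))"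

end

theory Submission
  imports Defs
begin

text \<open>
  Since \<open>q = a(u,w) k\<^sub>m(v)\<inverse>\<close> and \<open>a(u,w)\<close> multiplies the vector \<open>(1,1)\<close> by \<open>e\<^sup>w\<close>, the vector
  \<open>q\<inverse>(1,1) = e\<^sup>-\<^sup>w k\<^sub>m(v)(1,1)\<close> determines \<open>w\<close> and \<open>v\<close> as (elliptic) polar coordinates: an explicit
  real-linear function \<open>zeta\<close> of \<open>q\<close> equals \<open>e\<^sup>-\<^sup>w exp(i \<omega>\<^sub>m v)\<close>. As \<open>b\<^sub>m\<close> has frequency \<open>m \<omega>\<^sub>m\<close>, both
  \<open>f\<^sub>m\<close> and \<open>\<ell>\<^sub>m\<close> are polynomial in the phase of \<open>zeta\<close>, hence well defined and smooth.
  Differentiating \<open>q\<inverse>(1,1)\<close> gives \<open>dv = \<ell>\<^sub>m\<^sup>\<flat> / 3\<close>, and \<open>Z\<^sub>m - Y\<^sub>m = - \<ell> / 3\<close> gives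
  \<open>df\<^sub>m = - (2/3) dv k\<^sub>m l\<^sub>g(\<ell>) b\<^sub>m\<inverse> = - (2/9) \<ell>\<^sub>m\<^sup>\<flat> l\<^sub>g(\<lambda>(k\<^sub>m)\<ell>) f\<^sub>m\<close>. In the frame \<open>(q, 1)\<close> the spin
  connection contributes \<open>(1/2) q\<inverse> dq\<close>, i.e. the summand \<open>(1/2) id\<close> of \<open>A\<^sub>m\<close>.
\<close>

section \<open>Calculus of smooth maps\<close>

lemma Ck_on_has_derivative:
  assumes "Ck_on (Suc k) f U" "x \<in> U"
  shows "(f has_derivative frechet_derivative f (at x)) (at x)"
proof -
  have "f differentiable (at x)" using assms by simp
  then show ?thesis by (rule frechet_derivative_works[THEN iffD1])
qed

lemma Ck_on_cong:
  fixes f g :: "'a::euclidean_space \<Rightarrow> 'b::real_normed_vector"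
  assumes "open U"
  shows "(\<And>x. x \<in> U \<Longrightarrow> f x = g x) \<Longrightarrow> Ck_on k f U \<Longrightarrow> Ck_on k g U"
proof (induction k arbitrary: f g)
  case 0
  then show ?case by (simp cong: continuous_on_cong)
next
  case (Suc k)
  have D: "(g has_derivative frechet_derivative f (at x)) (at x)" if "x \<in> U" for x
    by (rule has_derivative_transform_within_open[OF Ck_on_has_derivative[OF Suc.prems(2) that] assms that Suc.prems(1)])
  have "g differentiable (at x)" if "x \<in> U" for x
    using D[OF that] unfolding differentiable_def by blast
  moreover have "Ck_on k (\<lambda>x. frechet_derivative g (at x) v) U" for v
  proof (rule Suc.IH)
    show "Ck_on k (\<lambda>x. frechet_derivative f (at x) v) U" using Suc.prems(2) by simp
    show "frechet_derivative f (at x) v = frechet_derivative g (at x) v" if "x \<in> U" for x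
      using frechet_derivative_at[OF D[OF that]] by (rule fun_cong)
  qed
  ultimately show ?case by simp
qed

text \<open>On an open set the derivative at a point is unique, so any explicitly known derivative
  \<open>D\<close> may stand in for \<open>frechet_derivative\<close>. Every closure property below
  feeds its differentiation rule into this lemma.\<close>

lemma Ck_on_SucI:
  fixes f :: "'a::euclidean_space \<Rightarrow> 'b::real_normed_vector"
  assumes "open U" and D: "\<And>x. x \<in> U \<Longrightarrow> (f has_derivative D x) (at x)"
    and k: "\<And>v. Ck_on k (\<lambda>x. D x v) U"
  shows "Ck_on (Suc k) f U"
proof -
  have "f differentiable (at x)" if "x \<in> U" for x
    using D[OF that] unfolding differentiable_def by blast
  moreover have "Ck_on k (\<lambda>x. frechet_derivative f (at x) v) U" for v
  proof (rule Ck_on_cong[OF \<open>open U\<close> _ k])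
    show "D x v = frechet_derivative f (at x) v" if "x \<in> U" for x
      using frechet_derivative_at[OF D[OF that]] by (rule fun_cong)
  qed
  ultimately show ?thesis by simp
qed

text \<open>In the base case differentiability gives continuity. Product and power rules produce
  undifferentiated factors, for which the order has to be lowered.\<close>

lemma Ck_on_SucD: "Ck_on (Suc k) f U \<Longrightarrow> Ck_on k f U"
proof (induction k arbitrary: f)
  case 0
  then show ?case
    by (simp add: continuous_at_imp_continuous_on differentiable_imp_continuous_within)
next
  case (Suc k)
  then show ?case by simp
qed

lemma Ck_on_subset: "Ck_on k f U \<Longrightarrow> V \<subseteq> U \<Longrightarrow> Ck_on k f V"
proof (induction k arbitrary: f)
  case 0
  then show ?case using continuous_on_subset by (simp, blast)
next
  case (Suc k)
  then show ?case by auto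
qed

lemma Ck_on_const: "open U \<Longrightarrow> Ck_on k (\<lambda>x. c) U"
proof (induction k arbitrary: c)
  case (Suc k)
  show ?case by (rule Ck_on_SucI[OF Suc.prems has_derivative_const Suc.IH[OF Suc.prems]])
qed auto

lemma Ck_on_linear:
  assumes "bounded_linear L" "open U"
  shows "Ck_on k L U"
proof (cases k)
  case 0
  then show ?thesis using assms linear_continuous_on by auto
next
  case (Suc k)
  have "Ck_on (Suc k) L U"
    by (rule Ck_on_SucI[OF assms(2) bounded_linear_imp_has_derivative[OF assms(1)] Ck_on_const[OF assms(2)]])
  then show ?thesis using Suc by simp
qed

lemma Ck_on_add:
  assumes "open U"
  shows "Ck_on k f U \<Longrightarrow> Ck_on k g U \<Longrightarrow> Ck_on k (\<lambda>x. f x + g x) U"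
proof (induction k arbitrary: f g)
  case 0
  then show ?case by (auto intro: continuous_on_add)
next
  case (Suc k)
  show ?case
    by (rule Ck_on_SucI[OF assms has_derivative_add[OF Ck_on_has_derivative[OF Suc.prems(1)]
          Ck_on_has_derivative[OF Suc.prems(2)]] Suc.IH])
      (use Suc.prems in \<open>simp_all only: Ck_on.simps simp_thms\<close>)
qed

lemma Ck_on_linear_compose:
  assumes "bounded_linear L" "open U"
  shows "Ck_on k f U \<Longrightarrow> Ck_on k (\<lambda>x. L (f x)) U"
proof (induction k arbitrary: f)
  case 0
  then show ?case using bounded_linear.continuous_on[OF assms(1)] by simp
next
  case (Suc k)
  show ?case
    by (rule Ck_on_SucI[OF assms(2) bounded_linear.has_derivative[OF assms(1)
            Ck_on_has_derivative[OF Suc.prems]] Suc.IH])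
      (use Suc.prems in \<open>simp_all only: Ck_on.simps simp_thms\<close>)
qed

lemma Ck_on_bilinear:
  assumes "bounded_bilinear B" "open U"
  shows "Ck_on k f U \<Longrightarrow> Ck_on k g U \<Longrightarrow> Ck_on k (\<lambda>x. B (f x) (g x)) U"
proof (induction k arbitrary: f g)
  case 0
  then show ?case using bounded_bilinear.continuous_on[OF assms(1)] by simp
next
  case (Suc k)
  have k: "Ck_on k f U" "Ck_on k g U" using Suc.prems Ck_on_SucD by blast+
  show ?case
    by (rule Ck_on_SucI[OF assms(2) bounded_bilinear.FDERIV[OF assms(1) Ck_on_has_derivative[OF Suc.prems(1)]
            Ck_on_has_derivative[OF Suc.prems(2)]] Ck_on_add[OF assms(2) Suc.IH Suc.IH]])
      (use Suc.prems k in \<open>simp_all only: Ck_on.simps simp_thms\<close>)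
qed

text \<open>Differentiation lowers the exponent to \<open>a - 1\<close>, so the induction runs over
  all exponents at once.\<close>

lemma Ck_on_powr:
  fixes f :: "'a::euclidean_space \<Rightarrow> real"
  assumes "open U" and pos: "\<And>x. x \<in> U \<Longrightarrow> f x > 0"
  shows "Ck_on k f U \<Longrightarrow> Ck_on k (\<lambda>x. f x powr a) U"
proof (induction k arbitrary: a)
  case 0
  then show ?case using pos by (auto intro!: continuous_on_powr dest: pos)
next
  case (Suc k)
  have k: "Ck_on k f U" using Suc.prems Ck_on_SucD by blast
  have D: "((\<lambda>x. f x powr a) has_derivative
      (\<lambda>v. f x powr (a - 1) * (a *\<^sub>R frechet_derivative f (at x) v))) (at x)" if "x \<in> U" for x
    using pos[OF that]
    by (auto intro!: derivative_eq_intros Ck_on_has_derivative[OF Suc.prems that] simp: powr_diff)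
  show ?case
    by (rule Ck_on_SucI[OF assms(1) D Ck_on_bilinear[OF bounded_bilinear_mult assms(1) Suc.IH[OF k]
          Ck_on_linear_compose[OF bounded_linear_scaleR_right assms(1)]]])
      (use Suc.prems in \<open>simp_all only: Ck_on.simps simp_thms\<close>)
qed

section \<open>Smooth maps on arbitrary subsets, through local extensions\<close>

lemma smooth_on_cong:
  assumes "\<And>x. x \<in> S \<Longrightarrow> f x = g x" "smooth_on S f"
  shows "smooth_on S g"
  using assms unfolding smooth_on_def by (metis IntD1)

lemma smooth_on_linear: "bounded_linear L \<Longrightarrow> smooth_on S L"
  unfolding smooth_on_def using Ck_on_linear[OF _ open_UNIV] by blast

lemma smooth_on_const: "smooth_on S (\<lambda>x. c)"
  unfolding smooth_on_def using Ck_on_const[OF open_UNIV] by blast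

lemma smooth_on_linear_compose:
  assumes "bounded_linear L" "smooth_on S f"
  shows "smooth_on S (\<lambda>x. L (f x))"
  unfolding smooth_on_def
proof
  fix x assume "x \<in> S"
  then obtain U F where "open U" "x \<in> U" "\<forall>k. Ck_on k F U" "\<forall>y\<in>S \<inter> U. f y = F y"
    using assms(2) unfolding smooth_on_def by blast
  then show "\<exists>U F. open U \<and> x \<in> U \<and> (\<forall>k. Ck_on k F U) \<and> (\<forall>y\<in>S \<inter> U. L (f y) = F y)"
    by (intro exI[of _ U] exI[of _ "\<lambda>x. L (F x)"]) (auto intro: Ck_on_linear_compose[OF assms(1)])
qed

lemma smooth_on_local_pair:
  assumes "smooth_on S f" "smooth_on S g" "x \<in> S"
  shows "\<exists>U F G. open U \<and> x \<in> U \<and> (\<forall>k. Ck_on k F U) \<and> (\<forall>k. Ck_on k G U) \<and>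
    (\<forall>y\<in>S \<inter> U. f y = F y) \<and> (\<forall>y\<in>S \<inter> U. g y = G y)"
proof -
  obtain U F where U: "open U" "x \<in> U" "\<forall>k. Ck_on k F U" "\<forall>y\<in>S \<inter> U. f y = F y"
    using assms(1,3) unfolding smooth_on_def by blast
  obtain V G where V: "open V" "x \<in> V" "\<forall>k. Ck_on k G V" "\<forall>y\<in>S \<inter> V. g y = G y"
    using assms(2,3) unfolding smooth_on_def by blast
  have "Ck_on k F (U \<inter> V)" "Ck_on k G (U \<inter> V)" for k
    using U(3) V(3) Ck_on_subset[of k F U "U \<inter> V"] Ck_on_subset[of k G V "U \<inter> V"] by simp_all
  with U V show ?thesis
    by (intro exI[of _ "U \<inter> V"] exI[of _ F] exI[of _ G]) auto
qed

lemma smooth_on_add: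
  assumes "smooth_on S f" "smooth_on S g"
  shows "smooth_on S (\<lambda>x. f x + g x)"
  unfolding smooth_on_def
proof
  fix x assume "x \<in> S"
  obtain U F G where "open U" "x \<in> U" "\<forall>k. Ck_on k F U" "\<forall>k. Ck_on k G U"
    "\<forall>y\<in>S \<inter> U. f y = F y" "\<forall>y\<in>S \<inter> U. g y = G y"
    using smooth_on_local_pair[OF assms \<open>x \<in> S\<close>] by blast
  then show "\<exists>U F. open U \<and> x \<in> U \<and> (\<forall>k. Ck_on k F U) \<and> (\<forall>y\<in>S \<inter> U. f y + g y = F y)"
    by (intro exI[of _ U] exI[of _ "\<lambda>x. F x + G x"]) (auto intro: Ck_on_add)
qed

lemma smooth_on_bilinear:
  assumes "bounded_bilinear B" "smooth_on S f" "smooth_on S g"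
  shows "smooth_on S (\<lambda>x. B (f x) (g x))"
  unfolding smooth_on_def
proof
  fix x assume "x \<in> S"
  obtain U F G where "open U" "x \<in> U" "\<forall>k. Ck_on k F U" "\<forall>k. Ck_on k G U"
    "\<forall>y\<in>S \<inter> U. f y = F y" "\<forall>y\<in>S \<inter> U. g y = G y"
    using smooth_on_local_pair[OF assms(2,3) \<open>x \<in> S\<close>] by blast
  then show "\<exists>U F. open U \<and> x \<in> U \<and> (\<forall>k. Ck_on k F U) \<and> (\<forall>y\<in>S \<inter> U. B (f y) (g y) = F y)"
    by (intro exI[of _ U] exI[of _ "\<lambda>x. B (F x) (G x)"]) (auto intro: Ck_on_bilinear[OF assms(1)])
qed

lemma smooth_on_powr:
  fixes f :: "'a::euclidean_space \<Rightarrow> real"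
  assumes "smooth_on S f" and pos: "\<And>x. x \<in> S \<Longrightarrow> f x > 0"
  shows "smooth_on S (\<lambda>x. f x powr a)"
  unfolding smooth_on_def
proof
  fix x assume x: "x \<in> S"
  obtain U F where U: "open U" "x \<in> U" "\<forall>k. Ck_on k F U" "\<forall>y\<in>S \<inter> U. f y = F y"
    using assms(1) x unfolding smooth_on_def by blast
  \<comment> \<open>The extension \<open>F\<close> is known to be positive only on
    \<open>S \<inter> U\<close>; continuity makes the set where it is positive open, and
    \<open>U\<close> is shrunk to it.\<close>
  have "continuous_on U F" using U(3)[THEN spec, of 0] by simp
  then have op: "open (U \<inter> F -` {0<..})"
    using U(1) continuous_on_open_vimage[of U F] by (metis Int_commute open_greaterThan)
  show "\<exists>U F. open U \<and> x \<in> U \<and> (\<forall>k. Ck_on k F U) \<and> (\<forall>y\<in>S \<inter> U. f y powr a = F y)"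
  proof (intro exI conjI allI)
    show "Ck_on k (\<lambda>x. F x powr a) (U \<inter> F -` {0<..})" for k
      by (rule Ck_on_powr[OF op]) (use U(3) in \<open>auto intro: Ck_on_subset[of k F U]\<close>)
  qed (use op x U pos[OF x] in auto)
qed

text \<open>The derivative of a local extension is also a derivative within \<open>S\<close>. This
  gives meaning to the derivatives within \<open>AdS3\<close> that occur in
  \<open>nabla\<close>.\<close>

lemma smooth_on_differentiable:
  assumes "smooth_on S f" "x \<in> S"
  shows "f differentiable (at x within S)"
proof -
  obtain U F where U: "open U" "x \<in> U" "\<forall>k. Ck_on k F U" "\<forall>y\<in>S \<inter> U. f y = F y"
    using assms unfolding smooth_on_def by blast
  then have "Ck_on (Suc 0) F U" by blast
  then have "F differentiable (at x)" using U(2) by simp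
  then obtain D where "(F has_derivative D) (at x)" unfolding differentiable_def by blast
  then have D: "(F has_derivative D) (at x within S)" by (rule has_derivative_at_withinI)
  obtain e where e: "e > 0" "ball x e \<subseteq> U"
    using U(1,2) open_contains_ball by blast
  have "(f has_derivative D) (at x within S)"
  proof (rule has_derivative_transform_within[OF D e(1) assms(2)])
    fix y assume "y \<in> S" "dist y x < e"
    then show "F y = f y" using U(4) e(2) by (auto simp: dist_commute subset_iff)
  qed
  then show ?thesis unfolding differentiable_def by blast
qed

section \<open>The group SU(1,1) and its Lie algebra\<close>

lemma cmat_eq_iff: "(A::cmat) = B \<longleftrightarrow>
    A $ 1 $ 1 = B $ 1 $ 1 \<and> A $ 1 $ 2 = B $ 1 $ 2 \<and> A $ 2 $ 1 = B $ 2 $ 1 \<and> A $ 2 $ 2 = B $ 2 $ 2"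
  by (auto simp: vec_eq_iff forall_2)

lemma bounded_bilinear_cmat_mult: "bounded_bilinear ((**) :: cmat \<Rightarrow> cmat \<Rightarrow> cmat)"
  unfolding bilinear_conv_bounded_bilinear[symmetric] bilinear_def
  by (auto intro!: linearI simp: cmat_eq_iff matrix_matrix_mult_def sum_2 algebra_simps)

lemma bounded_bilinear_cmat_vec: "bounded_bilinear ((*v) :: cmat \<Rightarrow> spinor \<Rightarrow> spinor)"
  unfolding bilinear_conv_bounded_bilinear[symmetric] bilinear_def
  by (auto intro!: linearI simp: vec_eq_iff forall_2 matrix_vector_mult_def sum_2 algebra_simps)

lemma bounded_linear_dagger: "bounded_linear dagger"
  by (rule linear_conv_bounded_linear[THEN iffD1], rule linearI) (simp_all add: cmat_eq_iff dagger_def)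

lemma bounded_linear_entry: "bounded_linear (\<lambda>A::cmat. A $ i $ j)"
  using bounded_linear_compose[OF bounded_linear_vec_nth[of j] bounded_linear_vec_nth[of i]] .

lemmas cmat_add_mult = bounded_bilinear.add_left[OF bounded_bilinear_cmat_mult]
lemmas cmat_mult_add = bounded_bilinear.add_right[OF bounded_bilinear_cmat_mult]
lemmas cmat_scaleR_mult = bounded_bilinear.scaleR_left[OF bounded_bilinear_cmat_mult]
lemmas cmat_mult_scaleR = bounded_bilinear.scaleR_right[OF bounded_bilinear_cmat_mult]
lemmas cmat_scaleR_vec = bounded_bilinear.scaleR_left[OF bounded_bilinear_cmat_vec]

lemma dagger_mult: "dagger (A ** B) = dagger B ** dagger A"
  by (simp add: cmat_eq_iff dagger_def matrix_matrix_mult_def sum_2 algebra_simps)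

lemma dagger_dagger [simp]: "dagger (dagger A) = A"
  by (simp add: cmat_eq_iff dagger_def)

lemma dagger_mat_1 [simp]: "dagger (mat 1) = mat 1"
  by (simp add: cmat_eq_iff dagger_def mat_def)

text \<open>\<open>matrix_inv\<close> is a choice among two-sided inverses; for square matrices a
  right inverse is two-sided, and then it is unique.\<close>

lemma matrix_inv_eqI:
  fixes A B :: cmat
  assumes "A ** B = mat 1"
  shows "matrix_inv A = B"
proof -
  have BA: "B ** A = mat 1" using assms matrix_left_right_inverse by blast
  have "\<exists>C. A ** C = mat 1 \<and> C ** A = mat 1" using assms BA by blast
  then have "A ** matrix_inv A = mat 1 \<and> matrix_inv A ** A = mat 1"
    unfolding matrix_inv_def by (rule someI_ex)
  then show ?thesis by (metis BA matrix_mul_assoc matrix_mul_lid matrix_mul_rid)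
qed

text \<open>These matrices form a real algebra (the split quaternions) that contains both SU(1,1)
  and its Lie algebra. Working in it reduces matrix identities to identities between pairs of
  complex numbers.\<close>

definition cm :: "complex \<Rightarrow> complex \<Rightarrow> cmat" where
  "cm a b = vector [vector [a, b], vector [cnj b, cnj a]]"

lemma cm_nth [simp]:
  "cm a b $ 1 $ 1 = a" "cm a b $ 1 $ 2 = b" "cm a b $ 2 $ 1 = cnj b" "cm a b $ 2 $ 2 = cnj a"
  by (simp_all add: cm_def)

lemma cm_eq_iff [simp]: "cm a b = cm c d \<longleftrightarrow> a = c \<and> b = d"
  by (auto simp: cmat_eq_iff)

lemma cm_mult: "cm a b ** cm c d = cm (a * c + b * cnj d) (a * d + b * cnj c)"
  by (simp add: cmat_eq_iff matrix_matrix_mult_def sum_2)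

lemma cm_add: "cm a b + cm c d = cm (a + c) (b + d)"
  by (simp add: cmat_eq_iff)

lemma cm_diff: "cm a b - cm c d = cm (a - c) (b - d)"
  by (simp add: cmat_eq_iff)

lemma cm_minus: "- cm a b = cm (- a) (- b)"
  by (simp add: cmat_eq_iff)

lemma cm_scaleR: "r *\<^sub>R cm a b = cm (of_real r * a) (of_real r * b)"
  by (simp only: cmat_eq_iff vector_scaleR_component cm_nth) (simp add: scaleR_conv_of_real)

lemma cm_dagger: "dagger (cm a b) = cm (cnj a) b"
  by (simp add: cmat_eq_iff dagger_def)

lemma cm_1: "mat 1 = cm 1 0"
  by (simp add: cmat_eq_iff mat_def)

lemma cm_0: "0 = cm 0 0"
  by (simp add: cmat_eq_iff)

lemmas cm_ops = cm_mult cm_add cm_diff cm_minus cm_scaleR cm_dagger cm_1 cm_0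

text \<open>Invariance of the form together with determinant 1 forces the second row to be the
  conjugate of the first in reversed order; what remains is one equation on the first row.\<close>

lemma SU11_iff: "h \<in> SU11 \<longleftrightarrow> (\<exists>a b. h = cm a b \<and> a * cnj a - b * cnj b = 1)"
proof
  assume "h \<in> SU11"
  then have h: "dagger h ** gamma0 ** h = gamma0" "det h = 1" by (auto simp: SU11_def)
  define p q r s where pqrs: "p = h $ 1 $ 1" "q = h $ 1 $ 2" "r = h $ 2 $ 1" "s = h $ 2 $ 2"
  have e: "cnj p * p - cnj r * r = 1" "cnj p * q - cnj r * s = 0" "p * s - q * r = 1"
    using h by (auto simp: cmat_eq_iff matrix_matrix_mult_def sum_2 gamma0_def dagger_def det_2 pqrs)
  have s: "s = cnj p" using e by algebra
  have q: "q = cnj r" using e by algebra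
  have "h = cm p q" using s q by (simp add: cmat_eq_iff pqrs)
  moreover have "p * cnj p - q * cnj q = 1" using e(1) q by (simp add: mult.commute)
  ultimately show "\<exists>a b. h = cm a b \<and> a * cnj a - b * cnj b = 1" by blast
next
  assume "\<exists>a b. h = cm a b \<and> a * cnj a - b * cnj b = 1"
  then obtain a b where "h = cm a b" "a * cnj a - b * cnj b = 1" by blast
  then show "h \<in> SU11"
    by (auto simp: SU11_def cmat_eq_iff matrix_matrix_mult_def sum_2 gamma0_def dagger_def det_2 algebra_simps)
qed

lemma SU11_cm: "cm a b \<in> SU11 \<longleftrightarrow> a * cnj a - b * cnj b = 1"
  by (auto simp: SU11_iff)

lemma SU11_cases:
  assumes "h \<in> SU11"
  obtains a b where "h = cm a b" "a * cnj a - b * cnj b = 1"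
  using assms by (auto simp: SU11_iff)

lemma SU11_inv_cm:
  assumes "a * cnj a - b * cnj b = 1"
  shows "matrix_inv (cm a b) = cm (cnj a) (- b)"
  by (rule matrix_inv_eqI) (use assms in \<open>simp add: cm_ops\<close>)

text \<open>The last formula expresses the inverse real-linearly in the entries, which later makes
  q^-1 visibly smooth in q.\<close>

lemma SU11_inv:
  assumes "h \<in> SU11"
  shows "matrix_inv h \<in> SU11" "h ** matrix_inv h = mat 1" "matrix_inv h ** h = mat 1"
    "matrix_inv h = gamma0 ** dagger h ** gamma0"
proof -
  obtain a b where h: "h = cm a b" "a * cnj a - b * cnj b = 1" using assms by (rule SU11_cases)
  show "matrix_inv h \<in> SU11" "h ** matrix_inv h = mat 1" "matrix_inv h ** h = mat 1"
    using h by (simp_all add: SU11_inv_cm SU11_cm cm_ops mult.commute)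
  show "matrix_inv h = gamma0 ** dagger h ** gamma0"
    unfolding h(1) SU11_inv_cm[OF h(2)]
    by (simp add: cmat_eq_iff gamma0_def dagger_def matrix_matrix_mult_def sum_2)
qed

lemma SU11_mult: "g \<in> SU11 \<Longrightarrow> h \<in> SU11 \<Longrightarrow> g ** h \<in> SU11"
proof (elim SU11_cases)
  fix a b c d assume *: "g = cm a b" "a * cnj a - b * cnj b = 1" "h = cm c d" "c * cnj c - d * cnj d = 1"
  have "(a * cnj a - b * cnj b) * (c * cnj c - d * cnj d) = 1" using * by simp
  then show "g ** h \<in> SU11" by (simp add: *(1,3) cm_mult SU11_cm algebra_simps)
qed

lemma SU11_1: "mat 1 \<in> SU11"
  by (simp add: cm_1 SU11_cm)

lemma SU11_dagger: "h \<in> SU11 \<Longrightarrow> dagger h \<in> SU11"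
  by (auto simp: SU11_iff cm_dagger mult.commute)

lemma SU11_inv_cancel:
  assumes "h \<in> SU11"
  shows "h ** (matrix_inv h ** A) = A" "matrix_inv h ** (h ** A) = A"
    "A ** h ** matrix_inv h = A" "A ** matrix_inv h ** h = A"
  using SU11_inv(2,3)[OF assms] by (simp_all add: matrix_mul_assoc) (simp_all add: matrix_mul_assoc[symmetric])

lemma SU11_inv_mult: "g \<in> SU11 \<Longrightarrow> h \<in> SU11 \<Longrightarrow> matrix_inv (g ** h) = matrix_inv h ** matrix_inv g"
  by (rule matrix_inv_eqI) (metis SU11_inv(2) SU11_inv_cancel(1) matrix_mul_assoc)

lemma SU11_inv_inv: "h \<in> SU11 \<Longrightarrow> matrix_inv (matrix_inv h) = h"
  by (rule matrix_inv_eqI) (rule SU11_inv(3))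

lemma SU11_dagger_inv: "h \<in> SU11 \<Longrightarrow> dagger (matrix_inv h) = matrix_inv (dagger h)"
  by (rule matrix_inv_eqI[symmetric]) (metis SU11_inv(3) dagger_mult dagger_mat_1)

section \<open>The Lie algebra su(1,1) and its identification with Minkowski space\<close>

lemma su11_iff: "\<xi> \<in> su11 \<longleftrightarrow> (\<exists>t b. \<xi> = cm (\<i> * of_real t) b)"
proof
  assume \<xi>: "\<xi> \<in> su11"
  define p q r s where pqrs: "p = \<xi> $ 1 $ 1" "q = \<xi> $ 1 $ 2" "r = \<xi> $ 2 $ 1" "s = \<xi> $ 2 $ 2"
  have e: "cnj p + p = 0" "q - cnj r = 0" "p + s = 0"
    using \<xi> by (auto simp: su11_def cmat_eq_iff matrix_matrix_mult_def sum_2 gamma0_def dagger_def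
        trace_def pqrs algebra_simps)
  have "\<xi> = cm (\<i> * of_real (Im p)) q"
    using e by (auto simp: cmat_eq_iff pqrs[symmetric] complex_eq_iff)
  then show "\<exists>t b. \<xi> = cm (\<i> * of_real t) b" by blast
next
  assume "\<exists>t b. \<xi> = cm (\<i> * of_real t) b"
  then show "\<xi> \<in> su11"
    by (auto simp: su11_def cmat_eq_iff matrix_matrix_mult_def sum_2 gamma0_def dagger_def trace_def)
qed

lemma su11_cases:
  assumes "\<xi> \<in> su11"
  obtains t b where "\<xi> = cm (\<i> * of_real t) b"
  using assms by (auto simp: su11_iff)

lemma lg_eq: "lg X = cm (\<i> * of_real (X $ 1 / 2)) ((\<i> * of_real (X $ 2) - of_real (X $ 3)) / 2)"
  by (simp add: cmat_eq_iff lg_def gam_def gamma0_def gamma1_def gamma2_def complex_eq_iff)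

lemma gam_lg: "gam X = (\<chi> i j. - 2 * \<i> * lg X $ i $ j)"
  by (simp add: vec_eq_iff lg_def)

lemma lg_in_su11: "lg X \<in> su11"
  unfolding su11_iff lg_eq by blast

lemma inj_lg: "inj lg"
proof (rule injI)
  fix X Y assume "lg X = lg Y"
  then have "X $ 1 = Y $ 1 \<and> X $ 2 = Y $ 2 \<and> X $ 3 = Y $ 3"
    by (auto simp: lg_eq complex_eq_iff)
  then show "X = Y" by (simp add: vec_eq_iff forall_3)
qed

lemma inv_lg_cm: "inv lg (cm (\<i> * of_real t) b) = vector [2 * t, 2 * Im b, - 2 * Re b]"
  by (rule inv_f_eq[OF inj_lg]) (simp add: lg_eq complex_eq_iff)

lemma lg_inv_lg: "\<xi> \<in> su11 \<Longrightarrow> lg (inv lg \<xi>) = \<xi>"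
  by (elim su11_cases) (simp add: inv_lg_cm lg_eq complex_eq_iff)

lemma inv_lg_lg: "inv lg (lg X) = X"
  using inj_lg by simp

lemma su11_add: "\<xi> \<in> su11 \<Longrightarrow> \<eta> \<in> su11 \<Longrightarrow> \<xi> + \<eta> \<in> su11"
  by (auto simp: su11_iff cm_add distrib_left[symmetric] of_real_add[symmetric] simp del: of_real_add)

lemma su11_scaleR: "\<xi> \<in> su11 \<Longrightarrow> r *\<^sub>R \<xi> \<in> su11"
  by (auto simp: su11_iff cm_scaleR) (metis mult.left_commute of_real_mult)

lemma su11_dagger: "\<xi> \<in> su11 \<Longrightarrow> dagger \<xi> \<in> su11"
  by (auto simp: su11_iff cm_dagger) (metis mult_minus_right of_real_minus)

lemma su11_conj: "h \<in> SU11 \<Longrightarrow> \<xi> \<in> su11 \<Longrightarrow> h ** \<xi> ** matrix_inv h \<in> su11"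
proof (elim SU11_cases su11_cases)
  fix a b t c assume *: "h = cm a b" "a * cnj a - b * cnj b = 1" "\<xi> = cm (\<i> * of_real t) c"
  \<comment> \<open>The upper left entry of the conjugate. The product already has the form
    \<open>cm\<close>, so it only remains to see that this entry is purely imaginary.\<close>
  let ?x = "(a * (\<i> * of_real t) + b * cnj c) * cnj a - (a * c - b * (\<i> * of_real t)) * cnj b"
  have x: "?x = \<i> * of_real (Im ?x)" by (simp add: complex_eq_iff algebra_simps)
  have "h ** \<xi> ** matrix_inv h = cm ?x (a * a * c - b * b * cnj c - 2 * \<i> * of_real t * a * b)"
    by (simp add: * SU11_inv_cm cm_ops algebra_simps)
  then show "h ** \<xi> ** matrix_inv h \<in> su11" using x su11_iff by metis
qed

lemma mink_inv_lg: "mink (inv lg (cm (\<i> * of_real t) b)) (inv lg (cm (\<i> * of_real s) c)) =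
    4 * Re (b * cnj c) - 4 * t * s"
  by (simp add: inv_lg_cm mink_def)

section \<open>Matrix exponentials\<close>

lemma mexp_eqI:
  assumes "(\<lambda>n. (1 / fact n) *\<^sub>R (((\<lambda>B. M ** B) ^^ n) (mat 1))) sums S"
  shows "mexp M = S"
  unfolding mexp_def using assms by (rule sums_unique[symmetric])

text \<open>Even powers of \<open>J\<close> are multiples of the identity and odd powers multiples
  of \<open>J\<close>, so the exponential series splits into the cosine and sine series.\<close>

lemma mexp_elliptic:
  assumes "J ** J = - mat 1"
  shows "mexp (t *\<^sub>R J) = cos t *\<^sub>R mat 1 + sin t *\<^sub>R J"
proof (rule mexp_eqI)
  have pow: "((\<lambda>B. (t *\<^sub>R J) ** B) ^^ n) (mat 1) =
      (if even n then ((- 1) ^ (n div 2) * t ^ n) *\<^sub>R mat 1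
       else ((- 1) ^ ((n - Suc 0) div 2) * t ^ n) *\<^sub>R J)" for n
  proof (induction n)
    case (Suc n)
    show ?case
    proof (cases "even n")
      case True
      then show ?thesis using Suc by (simp add: cmat_scaleR_mult cmat_mult_scaleR mult.left_commute)
    next
      case False
      then obtain k where "n = 2 * k + 1" by (elim oddE)
      then show ?thesis using Suc by (simp add: cmat_scaleR_mult cmat_mult_scaleR assms algebra_simps)
    qed
  qed simp
  have "(\<lambda>n. (cos_coeff n *\<^sub>R t ^ n) *\<^sub>R mat 1 + (sin_coeff n *\<^sub>R t ^ n) *\<^sub>R J) sums
      (cos t *\<^sub>R mat 1 + sin t *\<^sub>R J)"
    by (intro sums_add bounded_linear.sums[OF bounded_linear_scaleR_left] cos_converges sin_converges)
  moreover have "(cos_coeff n *\<^sub>R t ^ n) *\<^sub>R mat 1 + (sin_coeff n *\<^sub>R t ^ n) *\<^sub>R J =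
      (1 / fact n) *\<^sub>R (((\<lambda>B. (t *\<^sub>R J) ** B) ^^ n) (mat 1))" for n
    unfolding pow by (simp add: cos_coeff_def sin_coeff_def)
  ultimately show "(\<lambda>n. (1 / fact n) *\<^sub>R (((\<lambda>B. (t *\<^sub>R J) ** B) ^^ n) (mat 1))) sums
      (cos t *\<^sub>R mat 1 + sin t *\<^sub>R J)" by simp
qed

lemma mexp_hyperbolic:
  assumes "J ** J = mat 1"
  shows "mexp (t *\<^sub>R J) = cosh t *\<^sub>R mat 1 + sinh t *\<^sub>R J"
proof (rule mexp_eqI)
  have pow: "((\<lambda>B. (t *\<^sub>R J) ** B) ^^ n) (mat 1) = t ^ n *\<^sub>R (if even n then mat 1 else J)" for n
    by (induction n) (simp_all add: cmat_scaleR_mult cmat_mult_scaleR assms)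
  have "(\<lambda>n. (if even n then t ^ n /\<^sub>R fact n else 0) *\<^sub>R mat 1 + (if even n then 0 else t ^ n /\<^sub>R fact n) *\<^sub>R J) sums
      (cosh t *\<^sub>R mat 1 + sinh t *\<^sub>R J)"
    by (intro sums_add bounded_linear.sums[OF bounded_linear_scaleR_left] cosh_converges sinh_converges)
  moreover have "(if even n then t ^ n /\<^sub>R fact n else 0) *\<^sub>R mat 1 + (if even n then 0 else t ^ n /\<^sub>R fact n) *\<^sub>R J =
      (1 / fact n) *\<^sub>R (((\<lambda>B. (t *\<^sub>R J) ** B) ^^ n) (mat 1))" for n
    unfolding pow by (simp add: field_simps)
  ultimately show "(\<lambda>n. (1 / fact n) *\<^sub>R (((\<lambda>B. (t *\<^sub>R J) ** B) ^^ n) (mat 1))) sums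
      (cosh t *\<^sub>R mat 1 + sinh t *\<^sub>R J)" by simp
qed

text \<open>The series stops after its linear term. This is the case of the null direction
  \<open>ell\<close>.\<close>

lemma mexp_nilpotent:
  assumes "M ** M = 0"
  shows "mexp M = mat 1 + M"
proof (rule mexp_eqI)
  let ?f = "\<lambda>n. (1 / fact n) *\<^sub>R (((\<lambda>B. M ** B) ^^ n) (mat 1))"
  have "?f n = 0" if "n \<notin> {0, 1}" for n
  proof -
    have "2 \<le> n" using that by auto
    then obtain k where "n = Suc (Suc k)" by (metis add_2_eq_Suc le_Suc_ex)
    then show ?thesis
      by (simp add: matrix_mul_assoc assms bounded_bilinear.zero_left[OF bounded_bilinear_cmat_mult])
  qed
  then have "?f sums (\<Sum>n\<in>{0, 1}. ?f n)" by (intro sums_finite) auto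
  then show "?f sums (mat 1 + M)" by simp
qed

section \<open>Frames, spinors and the covariant derivative\<close>

lemma frame_act_1 [simp]: "frame_act u (mat 1) = u"
  by (simp add: frame_act_def matrix_inv_eqI)

lemma frame_act_mult:
  "g \<in> SU11 \<Longrightarrow> h \<in> SU11 \<Longrightarrow> frame_act (frame_act u g) h = frame_act u (g ** h)"
  by (simp add: frame_act_def SU11_inv_mult dagger_mult matrix_mul_assoc)

lemma spin_class_refl: "(u, v) \<in> spin_class u v"
  unfolding spin_class_def
  by (rule CollectI, rule exI[of _ "mat 1"]) (simp add: SU11_1 matrix_inv_eqI)

lemma spin_class_eqD:
  assumes "spin_class u v = spin_class u' v'"
  obtains h where "h \<in> SU11" "u' = frame_act u h" "v' = matrix_inv h *v v"
  using spin_class_refl[of u' v'] assms unfolding spin_class_def by blast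

lemma spin_class_act:
  assumes "h \<in> SU11"
  shows "spin_class (frame_act u h) (matrix_inv h *v v) = spin_class u v"
proof
  show "spin_class (frame_act u h) (matrix_inv h *v v) \<subseteq> spin_class u v"
  proof
    fix x assume "x \<in> spin_class (frame_act u h) (matrix_inv h *v v)"
    then obtain k where k: "k \<in> SU11" "x = (frame_act (frame_act u h) k, matrix_inv k *v (matrix_inv h *v v))"
      unfolding spin_class_def by blast
    then have "x = (frame_act u (h ** k), matrix_inv (h ** k) *v v)"
      using assms by (simp add: frame_act_mult SU11_inv_mult matrix_vector_mul_assoc)
    then show "x \<in> spin_class u v"
      unfolding spin_class_def using SU11_mult[OF assms k(1)] by blast
  qed
  show "spin_class u v \<subseteq> spin_class (frame_act u h) (matrix_inv h *v v)"
  proof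
    fix x assume "x \<in> spin_class u v"
    then obtain k where k: "k \<in> SU11" "x = (frame_act u k, matrix_inv k *v v)"
      unfolding spin_class_def by blast
    let ?l = "matrix_inv h ** k"
    have l: "?l \<in> SU11" using SU11_mult SU11_inv(1) assms k(1) by blast
    have "x = (frame_act (frame_act u h) ?l, matrix_inv ?l *v (matrix_inv h *v v))"
      using k assms l by (simp add: frame_act_mult SU11_inv_cancel SU11_inv_mult SU11_inv(1) SU11_inv_inv
          matrix_vector_mul_assoc)
    then show "x \<in> spin_class (frame_act u h) (matrix_inv h *v v)"
      unfolding spin_class_def using l by blast
  qed
qed

text \<open>SU(1,1) acts freely on frames, so the group element relating the two representatives is
  the identity.\<close>

lemma spin_class_inj:
  assumes "u \<in> frames" "spin_class u v = spin_class u w"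
  shows "v = w"
  using assms(2)
proof (rule spin_class_eqD)
  fix h assume h: "h \<in> SU11" "u = frame_act u h" "w = matrix_inv h *v v"
  have "fst u \<in> SU11" using assms(1) by (auto simp: frames_def)
  moreover have "fst u = fst u ** h" using h(2) by (metis frame_act_def fst_conv)
  ultimately have "h = mat 1" using SU11_inv(3) SU11_inv_cancel(2) by metis
  then show "v = w" using h(3) by (simp add: matrix_inv_eqI)
qed

section \<open>Tangent vectors, Clifford multiplication and inner product in a frame\<close>

lemma frame_proj_has_derivative:
  "(frame_proj has_derivative (\<lambda>\<xi>. fst u ** dagger (snd \<xi>) + fst \<xi> ** dagger (snd u))) (at u)"
proof -
  have "((\<lambda>u. fst u ** dagger (snd u)) has_derivative (\<lambda>\<xi>. fst u ** dagger (snd \<xi>) + fst \<xi> ** dagger (snd u))) (at u)"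
    by (rule bounded_bilinear.FDERIV[OF bounded_bilinear_cmat_mult])
      (intro bounded_linear_imp_has_derivative bounded_linear_fst
        bounded_linear_compose[OF bounded_linear_dagger bounded_linear_snd])+
  moreover have "frame_proj = (\<lambda>u. fst u ** dagger (snd u))" by (simp add: fun_eq_iff frame_proj_def)
  ultimately show ?thesis by simp
qed

text \<open>For \<xi> = (g_L a, g_R b) both the solder form and the differential of the projection
  depend only on a + b^\<dagger>, so the value does not depend on the lift \<xi>.\<close>

lemma frame_vec_eq:
  assumes "u \<in> frames"
  shows "frame_vec u X = 2 *\<^sub>R (fst u ** lg X ** dagger (snd u))"
  unfolding frame_vec_def
proof (rule the_equality)
  obtain gL gR where u: "u = (gL, gR)" "gL \<in> SU11" "gR \<in> SU11" using assms by (auto simp: frames_def)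
  have D: "frechet_derivative frame_proj (at u) = (\<lambda>\<xi>. fst u ** dagger (snd \<xi>) + fst \<xi> ** dagger (snd u))"
    by (rule frechet_derivative_at[OF frame_proj_has_derivative, symmetric])
  have zero: "0 \<in> su11" using su11_scaleR[OF lg_in_su11, of 0] by simp
  note z = bounded_bilinear.zero_right[OF bounded_bilinear_cmat_mult]
  have d0: "dagger 0 = 0" by (rule linear_0[OF bounded_linear.linear[OF bounded_linear_dagger]])
  \<comment> \<open>A convenient lift: the left factor carries the whole vector, and the 2
    compensates the half in the solder form.\<close>
  let ?\<xi> = "(gL ** (2 *\<^sub>R lg X), gR ** 0)"
  have "?\<xi> \<in> frame_tangent u"
    using su11_scaleR[OF lg_in_su11, of 2 X] zero
    unfolding frame_tangent_def u tangent_def fst_conv snd_conv by blast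
  moreover have "solder u ?\<xi> = X"
    using u by (simp add: solder_def omegaL_def omegaR_def SU11_inv_cancel d0 z inv_lg_lg)
  moreover have "2 *\<^sub>R (fst u ** lg X ** dagger (snd u)) = frechet_derivative frame_proj (at u) ?\<xi>"
    unfolding D by (simp add: u z d0 cmat_scaleR_mult cmat_mult_scaleR)
  ultimately show "\<exists>\<xi>\<in>frame_tangent u. solder u \<xi> = X \<and>
      2 *\<^sub>R (fst u ** lg X ** dagger (snd u)) = frechet_derivative frame_proj (at u) \<xi>" by blast
  fix V assume "\<exists>\<xi>\<in>frame_tangent u. solder u \<xi> = X \<and> V = frechet_derivative frame_proj (at u) \<xi>"
  then obtain a b where a: "a \<in> su11" "b \<in> su11" "solder u (gL ** a, gR ** b) = X"
      "V = frechet_derivative frame_proj (at u) (gL ** a, gR ** b)"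
    unfolding frame_tangent_def tangent_def u by auto
  have "X = inv lg ((1/2) *\<^sub>R (a + dagger b))"
    using a(3) u by (simp add: solder_def omegaL_def omegaR_def SU11_inv_cancel)
  then have "lg X = (1/2) *\<^sub>R (a + dagger b)"
    using lg_inv_lg su11_scaleR su11_add su11_dagger a(1,2) by simp
  then have two: "2 *\<^sub>R lg X = a + dagger b" by simp
  have "V = gL ** (a + dagger b) ** dagger gR"
    unfolding a(4) D by (simp add: u dagger_mult cmat_add_mult cmat_mult_add matrix_mul_assoc add.commute)
  also have "\<dots> = 2 *\<^sub>R (fst u ** lg X ** dagger (snd u))"
    unfolding two[symmetric] by (simp add: u cmat_scaleR_mult cmat_mult_scaleR)
  finally show "V = 2 *\<^sub>R (fst u ** lg X ** dagger (snd u))" .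
qed

text \<open>\<open>gam\<close> is \<open>lg\<close> times the scalar -2i, and scalars commute with
  matrix products. Equivariance thus passes from \<open>lg\<close> to Clifford
  multiplication.\<close>

lemma gam_commute: "lg X ** h = h ** lg Y \<Longrightarrow> gam X ** h = h ** gam Y"
proof -
  assume *: "lg X ** h = h ** lg Y"
  have "gam X ** h = (\<chi> i j. - 2 * \<i> * (lg X ** h) $ i $ j)"
    by (simp add: cmat_eq_iff matrix_matrix_mult_def sum_2 gam_lg algebra_simps)
  also have "\<dots> = h ** gam Y"
    unfolding * by (simp add: cmat_eq_iff matrix_matrix_mult_def sum_2 gam_lg algebra_simps)
  finally show ?thesis .
qed

text \<open>Another representative differs by some \<open>h\<close> with lg X = h lg X' h^-1. Hence
  \<open>gam\<close> intertwines the two spinor components, and both choices give the same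
  class.\<close>

lemma clifford_eq:
  assumes "u \<in> frames"
  shows "clifford (frame_vec u X) (spin_class u v) = spin_class u (gam X *v v)"
  unfolding clifford_def
proof (rule the_equality)
  show "\<exists>u'\<in>frames. \<exists>X' v'. frame_vec u X = frame_vec u' X' \<and> spin_class u v = spin_class u' v' \<and>
      spin_class u (gam X *v v) = spin_class u' (gam X' *v v')"
    using assms by blast
  fix \<Phi> assume "\<exists>u'\<in>frames. \<exists>X' v'. frame_vec u X = frame_vec u' X' \<and> spin_class u v = spin_class u' v' \<and>
      \<Phi> = spin_class u' (gam X' *v v')"
  then obtain u' X' v' where u': "u' \<in> frames" "frame_vec u X = frame_vec u' X'"
    "spin_class u v = spin_class u' v'" "\<Phi> = spin_class u' (gam X' *v v')" by blast
  obtain h where h: "h \<in> SU11" "u' = frame_act u h" "v' = matrix_inv h *v v"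
    using u'(3) by (rule spin_class_eqD)
  obtain gL gR where u: "u = (gL, gR)" "gL \<in> SU11" "gR \<in> SU11" using assms by (auto simp: frames_def)
  note dR = SU11_dagger[OF u(3)]
  have "gL ** lg X ** dagger gR = gL ** (h ** lg X' ** matrix_inv h) ** dagger gR"
    using u'(2) unfolding frame_vec_eq[OF assms] frame_vec_eq[OF u'(1)]
    by (simp add: h(2) u frame_act_def dagger_mult matrix_mul_assoc)
  then have "lg X = h ** lg X' ** matrix_inv h"
    using SU11_inv_cancel(2)[OF u(2)] SU11_inv_cancel(3)[OF dR] by metis
  then have "lg X ** h = h ** lg X'" using SU11_inv_cancel(4)[OF h(1)] by metis
  then have "gam X ** h = h ** gam X'" by (rule gam_commute)
  then have "matrix_inv h ** gam X = gam X' ** matrix_inv h"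
    using SU11_inv_cancel[OF h(1)] by (metis matrix_mul_assoc)
  then have "gam X' *v v' = matrix_inv h *v (gam X *v v)"
    by (simp add: h(3) matrix_vector_mul_assoc)
  then show "\<Phi> = spin_class u (gam X *v v)"
    using u'(4) h(2) spin_class_act[OF h(1)] by simp
qed

lemma spin_scale_eq:
  assumes "u \<in> frames"
  shows "spin_scale c (spin_class u v) = spin_class u (c *s v)"
  unfolding spin_scale_def
proof (rule the_equality)
  show "\<exists>u'\<in>frames. \<exists>v'. spin_class u v = spin_class u' v' \<and> spin_class u (c *s v) = spin_class u' (c *s v')"
    using assms by blast
  fix \<Phi> assume "\<exists>u'\<in>frames. \<exists>v'. spin_class u v = spin_class u' v' \<and> \<Phi> = spin_class u' (c *s v')"
  then obtain u' v' where u': "spin_class u v = spin_class u' v'" "\<Phi> = spin_class u' (c *s v')" by blast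
  obtain h where h: "h \<in> SU11" "u' = frame_act u h" "v' = matrix_inv h *v v"
    using u'(1) by (rule spin_class_eqD)
  show "\<Phi> = spin_class u (c *s v)"
    using u'(2) h spin_class_act[OF h(1), of u "c *s v"] by (simp add: vector_scalar_commute)
qed

lemma SU11_preserves_form:
  assumes "h \<in> SU11"
  shows "(\<Sum>i\<in>UNIV. cnj ((h *v v) $ i) * (gamma0 *v (h *v w)) $ i) =
    (\<Sum>i\<in>UNIV. cnj (v $ i) * (gamma0 *v w) $ i)"
  using assms
proof (rule SU11_cases)
  fix a b assume h: "h = cm a b" "a * cnj a - b * cnj b = 1"
  have "(\<Sum>i\<in>UNIV. cnj ((h *v v) $ i) * (gamma0 *v (h *v w)) $ i) =
    (a * cnj a - b * cnj b) * (\<Sum>i\<in>UNIV. cnj (v $ i) * (gamma0 *v w) $ i)"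
    by (simp add: h(1) sum_2 matrix_vector_mult_def gamma0_def algebra_simps)
  then show ?thesis using h(2) by simp
qed

lemma spin_inner_eq:
  assumes "u \<in> frames"
  shows "spin_inner (spin_class u v) (spin_class u w) = (\<Sum>i\<in>UNIV. cnj (v $ i) * (gamma0 *v w) $ i)"
  unfolding spin_inner_def
proof (rule the_equality)
  show "\<exists>u'\<in>frames. \<exists>v' w'. spin_class u v = spin_class u' v' \<and> spin_class u w = spin_class u' w' \<and>
      (\<Sum>i\<in>UNIV. cnj (v $ i) * (gamma0 *v w) $ i) = (\<Sum>i\<in>UNIV. cnj (v' $ i) * (gamma0 *v w') $ i)"
    using assms by blast
  fix c assume "\<exists>u'\<in>frames. \<exists>v' w'. spin_class u v = spin_class u' v' \<and> spin_class u w = spin_class u' w' \<and>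
      c = (\<Sum>i\<in>UNIV. cnj (v' $ i) * (gamma0 *v w') $ i)"
  then obtain u' v' w' where u': "u' \<in> frames" "spin_class u v = spin_class u' v'"
      "spin_class u w = spin_class u' w'" "c = (\<Sum>i\<in>UNIV. cnj (v' $ i) * (gamma0 *v w') $ i)" by blast
  obtain h where h: "h \<in> SU11" "u' = frame_act u h" "v' = matrix_inv h *v v"
    using u'(2) by (rule spin_class_eqD)
  \<comment> \<open>The element \<open>h\<close> was obtained from the first argument; freeness of
    the action shows that it transports the second one as well.\<close>
  have "w' = matrix_inv h *v w"
    by (rule spin_class_inj[OF u'(1)]) (use u'(3) h(2) spin_class_act[OF h(1)] in simp)
  then show "c = (\<Sum>i\<in>UNIV. cnj (v $ i) * (gamma0 *v w) $ i)"
    using u'(4) h(3) SU11_preserves_form[OF SU11_inv(1)[OF h(1)]] by simp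
qed

section \<open>Curves in AdS3 and differentiation along them\<close>

lemma tangent_curve:
  assumes "q \<in> AdS3" "X \<in> tangent q"
  obtains c T where "open T" "(0::real) \<in> T" "c 0 = q" "\<And>t. t \<in> T \<Longrightarrow> c t \<in> AdS3"
    "(c has_vector_derivative X) (at 0)"
proof -
  obtain x b where X: "X = q ** cm (\<i> * of_real x) b"
    using assms(2) by (auto simp: tangent_def su11_iff)
  define \<xi> where "\<xi> = cm (\<i> * of_real x) b"
  \<comment> \<open>The matrix 1 + t \<xi> has determinant 1 + t^2 d. Dividing by the square root
    puts the line q (1 + t \<xi>) into SU(1,1) for t in \<open>T\<close>; as the factor is
    stationary at 0, the velocity there stays q \<xi>.\<close>
  define d where "d = x\<^sup>2 - (cmod b)\<^sup>2"
  define T where "T = {t::real. 1 + t\<^sup>2 * d > 0}"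
  define r where "r = (\<lambda>t. (1 + t\<^sup>2 * d) powr (- 1/2))"
  define c where "c = (\<lambda>t. r t *\<^sub>R (q ** (mat 1 + t *\<^sub>R \<xi>)))"
  have "open T" unfolding T_def by (intro open_Collect_less continuous_intros)
  moreover have "0 \<in> T" by (simp add: T_def)
  moreover have "c 0 = q" by (simp add: c_def r_def)
  moreover have "c t \<in> AdS3" if "t \<in> T" for t
  proof -
    have pos: "1 + t\<^sup>2 * d > 0" using that by (simp add: T_def)
    have "(r t)\<^sup>2 = (1 + t\<^sup>2 * d) powr (- 1)"
      unfolding r_def by (simp add: power2_eq_square powr_add[symmetric])
    then have r: "(r t)\<^sup>2 * (1 + t\<^sup>2 * d) = 1" using pos by (simp add: powr_minus)
    have n: "b * cnj b = of_real ((cmod b)\<^sup>2)" by (metis complex_norm_square)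
    have "r t *\<^sub>R (mat 1 + t *\<^sub>R \<xi>) = cm (of_real (r t) * (1 + \<i> * of_real (t * x))) (of_real (r t) * (of_real t * b))"
      by (simp add: \<xi>_def cm_ops algebra_simps)
    moreover have "of_real (r t) * (1 + \<i> * of_real (t * x)) * cnj (of_real (r t) * (1 + \<i> * of_real (t * x))) -
        of_real (r t) * (of_real t * b) * cnj (of_real (r t) * (of_real t * b)) = of_real ((r t)\<^sup>2 * (1 + t\<^sup>2 * d))"
    proof -
      have "of_real (r t) * (of_real t * b) * cnj (of_real (r t) * (of_real t * b)) =
          of_real ((r t)\<^sup>2 * t\<^sup>2) * (b * cnj b)" by (simp add: power2_eq_square)
      then show ?thesis unfolding n d_def using n by (auto simp: power2_eq_square algebra_simps)
    qed
    ultimately have "r t *\<^sub>R (mat 1 + t *\<^sub>R \<xi>) \<in> SU11" using r by (simp add: SU11_cm)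
    then have "q ** (r t *\<^sub>R (mat 1 + t *\<^sub>R \<xi>)) \<in> SU11" by (rule SU11_mult[OF assms(1)])
    then show ?thesis by (simp add: c_def cmat_mult_scaleR)
  qed
  moreover have "(c has_vector_derivative X) (at 0)"
  proof -
    have r0: "(r has_real_derivative 0) (at 0)"
      unfolding r_def by (auto intro!: derivative_eq_intros)
    have "((\<lambda>t. q ** (mat 1 + t *\<^sub>R \<xi>)) has_vector_derivative q ** (0 + 1 *\<^sub>R \<xi>)) (at 0)"
      by (intro bounded_linear.has_vector_derivative[OF bounded_bilinear.bounded_linear_right[OF bounded_bilinear_cmat_mult]])
        (auto intro!: derivative_eq_intros)
    then have "(c has_vector_derivative r 0 *\<^sub>R (q ** (0 + 1 *\<^sub>R \<xi>)) + 0 *\<^sub>R (q ** (mat 1 + 0 *\<^sub>R \<xi>))) (at 0)"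
      unfolding c_def by (rule has_vector_derivative_scaleR[OF r0])
    then show ?thesis by (simp add: X \<xi>_def r_def)
  qed
  ultimately show thesis by (rule that)
qed

text \<open>A derivative within \<open>S\<close> may be ambiguous in directions transverse to
  \<open>S\<close>. On the velocity of a curve in \<open>S\<close> it is forced to be the velocity
  of the image curve, and this is how derivatives are computed and compared below.\<close>

lemma smooth_on_along_curve:
  assumes "smooth_on S f" "open T" "(0::real) \<in> T" "\<And>t. t \<in> T \<Longrightarrow> c t \<in> S"
    "(c has_vector_derivative X) (at 0)"
  shows "((\<lambda>t. f (c t)) has_vector_derivative frechet_derivative f (at (c 0) within S) X) (at 0)"
proof -
  let ?D = "frechet_derivative f (at (c 0) within S)"
  have D: "(f has_derivative ?D) (at (c 0) within S)"
    using smooth_on_differentiable[OF assms(1)] assms(3,4) frechet_derivative_works by blast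
  have DT: "(f has_derivative ?D) (at (c 0) within c ` T)"
    by (rule has_derivative_subset[OF D]) (use assms(4) in blast)
  have "((\<lambda>t. f (c t)) has_derivative (\<lambda>t. ?D (t *\<^sub>R X))) (at 0 within T)"
    by (rule has_derivative_in_compose[OF has_derivative_at_withinI[OF
            assms(5)[unfolded has_vector_derivative_def]] DT])
  moreover have "?D (t *\<^sub>R X) = t *\<^sub>R ?D X" for t
    by (rule linear_scale[OF has_derivative_linear[OF D]])
  ultimately show ?thesis
    using at_within_open[OF assms(3,2)] by (simp add: has_vector_derivative_def)
qed

lemma has_vector_derivative_eq_on_open:
  assumes "(f has_vector_derivative a) (at x)" "(g has_vector_derivative b) (at x)"
    "open T" "x \<in> T" "\<And>t. t \<in> T \<Longrightarrow> f t = g t"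
  shows "a = b"
  using has_vector_derivative_transform_within_open[OF assms(1,3,4,5)] assms(2)
    vector_derivative_unique_at by blast

text \<open>A section \<open>s = (g\<^sub>L, g\<^sub>R)\<close> differs from \<open>q \<mapsto> (q, 1)\<close> by the gauge transformation with inverse
  \<open>g\<^sub>R\<^sup>\<dagger>\<close>, so that \<open>v = g\<^sub>R\<^sup>\<dagger> v\<^sub>0\<close>; differentiating this and \<open>g\<^sub>L g\<^sub>R\<^sup>\<dagger> = q\<close> along a curve shows that the
  class does not depend on the representative.\<close>

lemma nabla_eq:
  assumes rep: "represents \<psi> (\<lambda>q. (q, mat 1)) v0" and q: "q \<in> AdS3" and X: "X \<in> tangent q"
  shows "nabla \<psi> q X = spin_class (q, mat 1)
    (frechet_derivative v0 (at q within AdS3) X + (1/2) *\<^sub>R (matrix_inv q ** X) *v v0 q)"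
proof -
  obtain c T where c: "open T" "(0::real) \<in> T" "c 0 = q" "\<And>t. t \<in> T \<Longrightarrow> c t \<in> AdS3"
    "(c has_vector_derivative X) (at 0)" by (rule tangent_curve[OF q X]) blast
  have gauge: "spin_class (s q)
       (frechet_derivative v (at q within AdS3) X
        + spin_connection (s q) (frechet_derivative s (at q within AdS3) X) *v v q) =
      spin_class (q, mat 1)
    (frechet_derivative v0 (at q within AdS3) X + (1/2) *\<^sub>R (matrix_inv q ** X) *v v0 q)"
    if sv: "represents \<psi> s v" for s v
  proof -
    have gauge_rel: "\<exists>h\<in>SU11. s p = frame_act (p, mat 1) h \<and> v p = matrix_inv h *v v0 p"
      if "p \<in> AdS3" for p
    proof -
      have "spin_class (p, mat 1) (v0 p) = spin_class (s p) (v p)"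
        using rep sv that by (simp add: represents_def)
      then show ?thesis by (rule spin_class_eqD) blast
    qed
    have smooth: "smooth_on AdS3 s" "smooth_on AdS3 v" "smooth_on AdS3 v0"
      using rep sv by (auto simp: represents_def smooth_frame_def)
    have proj: "fst (s p) ** dagger (snd (s p)) = p" if "p \<in> AdS3" for p
      using sv that by (auto simp: represents_def smooth_frame_def frame_proj_def)
    have v: "v p = dagger (snd (s p)) *v v0 p" if "p \<in> AdS3" for p
      using gauge_rel[OF that] by (auto simp: frame_act_def)
    define sX where "sX = frechet_derivative s (at q within AdS3) X"
    define vX where "vX = frechet_derivative v (at q within AdS3) X"
    define v0X where "v0X = frechet_derivative v0 (at q within AdS3) X"
    have ds: "((\<lambda>t. s (c t)) has_vector_derivative sX) (at 0)"
      and dv: "((\<lambda>t. v (c t)) has_vector_derivative vX) (at 0)"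
      and dv0: "((\<lambda>t. v0 (c t)) has_vector_derivative v0X) (at 0)"
      using smooth[THEN smooth_on_along_curve[OF _ c(1,2,4,5)]] c(3)
      by (simp_all add: sX_def vX_def v0X_def)
    have dL: "((\<lambda>t. fst (s (c t))) has_vector_derivative fst sX) (at 0)"
      by (rule bounded_linear.has_vector_derivative[OF bounded_linear_fst ds])
    have dR: "((\<lambda>t. dagger (snd (s (c t)))) has_vector_derivative dagger (snd sX)) (at 0)"
      by (rule bounded_linear.has_vector_derivative[OF
            bounded_linear_compose[OF bounded_linear_dagger bounded_linear_snd] ds])
    have 1: "fst (s q) ** dagger (snd sX) + fst sX ** dagger (snd (s q)) = X"
      using has_vector_derivative_eq_on_open[OF
          bounded_bilinear.has_vector_derivative[OF bounded_bilinear_cmat_mult dL dR] c(5) c(1,2)]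
        proj c(3,4) by simp
    have 2: "vX = dagger (snd (s q)) *v v0X + dagger (snd sX) *v v0 q"
      using has_vector_derivative_eq_on_open[OF dv
          bounded_bilinear.has_vector_derivative[OF bounded_bilinear_cmat_vec dR dv0] c(1,2)]
        v c(3,4) by simp
    obtain h where h: "h \<in> SU11" "s q = frame_act (q, mat 1) h" "v q = matrix_inv h *v v0 q"
      using gauge_rel[OF q] by blast
    define k where "k = matrix_inv h"
    define e where "e = dagger (snd sX)"
    have k: "k \<in> SU11" "matrix_inv k = h" using SU11_inv(1) SU11_inv_inv h(1) by (auto simp: k_def)
    have sq: "fst (s q) = q ** h" "snd (s q) = dagger k" using h(2) by (simp_all add: frame_act_def k_def)
    have iL: "matrix_inv (fst (s q)) = k ** matrix_inv q"
      unfolding sq k_def using SU11_inv_mult q h(1) by blast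
    have iR: "dagger (matrix_inv (snd (s q)) ** snd sX) = e ** h"
      using k unfolding sq e_def dagger_mult by (simp add: SU11_dagger SU11_dagger_inv)
    \<comment> \<open>The differentiated projection \<open>1\<close> is solved for the left
      component; multiplication by \<open>h\<close> from the right removes k = h^-1.\<close>
    have 3: "fst sX = X ** h - q ** h ** e ** h"
    proof -
      have "fst sX ** k = X - q ** h ** e" using 1 sq by (simp add: e_def algebra_simps)
      then have "fst sX ** k ** h = (X - q ** h ** e) ** h" by simp
      then show ?thesis
        using SU11_inv_cancel(4)[OF h(1)]
        by (simp add: k_def bounded_bilinear.diff_left[OF bounded_bilinear_cmat_mult])
    qed
    have 4: "k ** matrix_inv q ** fst sX = k ** matrix_inv q ** X ** h - e ** h"
    proof -
      have "k ** matrix_inv q ** (q ** h ** e ** h) = k ** (matrix_inv q ** q) ** h ** e ** h"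
        by (simp add: matrix_mul_assoc)
      also have "\<dots> = e ** h" using SU11_inv(3)[OF q] SU11_inv(3)[OF h(1)] by (simp add: k_def)
      finally show ?thesis unfolding 3
        by (simp add: bounded_bilinear.diff_right[OF bounded_bilinear_cmat_mult] matrix_mul_assoc)
    qed
    \<comment> \<open>The right Maurer-Cartan term equals \<open>e ** h\<close>, and the left one
      contains \<open>- e ** h\<close>; half their difference therefore keeps the full
      \<open>- e ** h\<close>.\<close>
    have 5: "spin_connection (s q) sX = (1/2) *\<^sub>R (k ** matrix_inv q ** X ** h) - e ** h"
      unfolding spin_connection_def omegaL_def omegaR_def iL iR 4
      by (simp add: scaleR_diff_right)
    have hk: "h ** k = mat 1" using SU11_inv(2)[OF h(1)] by (simp add: k_def)
    have "spin_connection (s q) sX *v v q = ((1/2) *\<^sub>R (k ** matrix_inv q ** X ** (h ** k)) - e ** (h ** k)) *v v0 q"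
      unfolding 5 h(3) k_def[symmetric]
      by (simp add: matrix_vector_mul_assoc bounded_bilinear.diff_left[OF bounded_bilinear_cmat_mult]
          cmat_scaleR_mult matrix_mul_assoc)
    \<comment> \<open>The term \<open>e *v v0 q\<close> from differentiating the gauge factor
      cancels the one in the connection. The remaining common factor \<open>k\<close> is the change
      of representative.\<close>
    then have "vX + spin_connection (s q) sX *v v q = k *v (v0X + (1/2) *\<^sub>R (matrix_inv q ** X) *v v0 q)"
      unfolding hk 2 sq
      by (simp add: e_def[symmetric] bounded_bilinear.diff_left[OF bounded_bilinear_cmat_vec]
          bounded_bilinear.add_right[OF bounded_bilinear_cmat_vec] cmat_scaleR_vec
          bounded_bilinear.scaleR_right[OF bounded_bilinear_cmat_vec] matrix_vector_mul_assoc matrix_mul_assoc)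
    then show ?thesis
      unfolding vX_def[symmetric] sX_def[symmetric] v0X_def[symmetric] h(2) k_def
      by (simp add: spin_class_act[OF h(1)])
  qed
  show ?thesis
    unfolding nabla_def
  proof (rule the_equality, goal_cases)
    case 1
    show ?case by (rule exI, rule exI, rule conjI[OF rep], rule gauge[OF rep, symmetric])
  next
    case (2 \<Phi>)
    then obtain s v where sv: "represents \<psi> s v" "\<Phi> = spin_class (s q)
       (frechet_derivative v (at q within AdS3) X
        + spin_connection (s q) (frechet_derivative s (at q within AdS3) X) *v v q)" by blast
    show ?case unfolding sv(2) by (rule gauge[OF sv(1)])
  qed
qed

section \<open>The decomposition of SU(1,1)\<close>

lemma basis_nth [simp]:
  "X0 $ 1 = 1" "X0 $ 2 = 0" "X0 $ 3 = 0" "X1 $ 1 = 0" "X1 $ 2 = 1" "X1 $ 3 = 0"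
  "X2 $ 1 = 0" "X2 $ 2 = 0" "X2 $ 3 = 1"
  by (simp_all add: X0_def X1_def X2_def axis_def)

section \<open>Elliptic one-parameter subgroups and the curves k_m and b_m\<close>

definition rot :: "real \<Rightarrow> real \<Rightarrow> real \<Rightarrow> cmat" where
  "rot p q t = cos t *\<^sub>R mat 1 + sin t *\<^sub>R cm (\<i> * of_real p) (\<i> * of_real q)"

lemma rot_cm: "rot p q t = cm (of_real (cos t) + \<i> * of_real (p * sin t)) (\<i> * of_real (q * sin t))"
  by (simp add: rot_def cm_ops algebra_simps)

text \<open>The generator is 2 l_g(p X0 + q X1), and its square is the Minkowski square q^2 - p^2 of
  that vector times the identity; the hypothesis says that the vector is unit timelike.\<close>

lemma rot_generator_square:
  assumes "p\<^sup>2 - q\<^sup>2 = 1"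
  shows "cm (\<i> * of_real p) (\<i> * of_real q) ** cm (\<i> * of_real p) (\<i> * of_real q) = - mat 1"
proof -
  have "q * q - p * p = - 1" using assms by (simp add: power2_eq_square)
  then have "complex_of_real (q * q - p * p) = - 1" by simp
  then show ?thesis by (simp add: cm_ops algebra_simps)
qed

lemma mexp_rot: "p\<^sup>2 - q\<^sup>2 = 1 \<Longrightarrow> mexp (t *\<^sub>R cm (\<i> * of_real p) (\<i> * of_real q)) = rot p q t"
  unfolding rot_def by (rule mexp_elliptic[OF rot_generator_square])

lemma rot_in_SU11:
  assumes "p\<^sup>2 - q\<^sup>2 = 1"
  shows "rot p q t \<in> SU11"
proof -
  have "(cos t)\<^sup>2 + p\<^sup>2 * (sin t)\<^sup>2 - q\<^sup>2 * (sin t)\<^sup>2 = (cos t)\<^sup>2 + (p\<^sup>2 - q\<^sup>2) * (sin t)\<^sup>2"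
    by (simp add: algebra_simps)
  also have "\<dots> = 1" using assms by simp
  finally show ?thesis
    by (simp add: rot_cm SU11_cm complex_eq_iff power2_eq_square algebra_simps)
qed

lemma rot_inv:
  assumes "p\<^sup>2 - q\<^sup>2 = 1"
  shows "matrix_inv (rot p q t) = rot p q (- t)"
  using rot_in_SU11[OF assms, of t] unfolding rot_cm SU11_cm by (simp add: SU11_inv_cm)

lemma rot_has_vector_derivative:
  assumes "p\<^sup>2 - q\<^sup>2 = 1" "(f has_real_derivative f') (at x)"
  shows "((\<lambda>x. rot p q (f x)) has_vector_derivative
    f' *\<^sub>R (rot p q (f x) ** cm (\<i> * of_real p) (\<i> * of_real q))) (at x)"
proof -
  let ?J = "cm (\<i> * of_real p) (\<i> * of_real q)"
  have "((\<lambda>x. cos (f x)) has_real_derivative - sin (f x) * f') (at x)"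
    "((\<lambda>x. sin (f x)) has_real_derivative cos (f x) * f') (at x)"
    using assms(2) by (auto intro!: derivative_eq_intros)
  then have "((\<lambda>x. rot p q (f x)) has_vector_derivative
      (- sin (f x) * f') *\<^sub>R mat 1 + (cos (f x) * f') *\<^sub>R ?J) (at x)"
    unfolding rot_def
    by (intro has_vector_derivative_add bounded_linear.has_vector_derivative[OF bounded_linear_scaleR_left])
      (simp_all add: has_real_derivative_iff_has_vector_derivative)
  moreover have "(- sin (f x) * f') *\<^sub>R mat 1 + (cos (f x) * f') *\<^sub>R ?J = f' *\<^sub>R (rot p q (f x) ** ?J)"
    by (simp add: rot_def cmat_add_mult cmat_scaleR_mult rot_generator_square[OF assms(1)] scaleR_add_right scaleR_diff_right mult.commute)
  ultimately show ?thesis by simp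
qed

text \<open>\<open>pz\<close>, \<open>qz\<close> are the coordinates of Z_m divided by \<omega>_m,
  and \<open>py\<close>, \<open>qy\<close> those of Y_m divided by m \<omega>_m; after this
  normalization both vectors are unit timelike.\<close>

definition pz :: "nat \<Rightarrow> real" where "pz m = - (((om m)\<^sup>2 + 9) / (6 * om m))"
definition qz :: "nat \<Rightarrow> real" where "qz m = ((om m)\<^sup>2 - 9) / (6 * om m)"
definition py :: "nat \<Rightarrow> real" where "py m = - (((om m)\<^sup>2 + 11) / (6 * (real m * om m)))"
definition qy :: "nat \<Rightarrow> real" where "qy m = ((om m)\<^sup>2 - 7) / (6 * (real m * om m))"

lemma om_pos: "m \<ge> 2 \<Longrightarrow> om m > 0"
proof -
  assume "m \<ge> 2"
  then have "(real m)\<^sup>2 \<ge> 2\<^sup>2" by (intro power_mono) auto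
  then show ?thesis by (simp add: om_def)
qed

lemma om_square: "m \<ge> 2 \<Longrightarrow> (real m)\<^sup>2 * (om m)\<^sup>2 = (om m)\<^sup>2 + 2"
proof -
  assume "m \<ge> 2"
  then have "(real m)\<^sup>2 \<ge> 2\<^sup>2" by (intro power_mono) auto
  then show ?thesis by (simp add: om_def field_simps)
qed

text \<open>The Minkowski squares of Z_m and Y_m are -\<omega>_m^2 and -(\<omega>_m^2 + 2). The
  choice of \<omega>_m turns the latter into -(m \<omega>_m)^2, so that b_m rotates exactly m times
  as fast as k_m.\<close>

lemma pq_unit:
  assumes "m \<ge> 2"
  shows "(pz m)\<^sup>2 - (qz m)\<^sup>2 = 1" "(py m)\<^sup>2 - (qy m)\<^sup>2 = 1"
proof -
  have o: "om m \<noteq> 0" "real m \<noteq> 0" using om_pos[OF assms] assms by auto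
  have "((om m)\<^sup>2 + 9)\<^sup>2 - ((om m)\<^sup>2 - 9)\<^sup>2 = (6 * om m)\<^sup>2" by (simp add: power2_eq_square algebra_simps)
  then show "(pz m)\<^sup>2 - (qz m)\<^sup>2 = 1" using o
    unfolding pz_def qz_def power2_minus power_divide diff_divide_distrib[symmetric] by simp
  have "((om m)\<^sup>2 + 11)\<^sup>2 - ((om m)\<^sup>2 - 7)\<^sup>2 = 36 * ((om m)\<^sup>2 + 2)" by (simp add: power2_eq_square algebra_simps)
  also have "\<dots> = (6 * (real m * om m))\<^sup>2" unfolding om_square[OF assms, symmetric] by (simp add: power_mult_distrib)
  finally show "(py m)\<^sup>2 - (qy m)\<^sup>2 = 1" using o
    unfolding py_def qy_def power2_minus power_divide diff_divide_distrib[symmetric] by simp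
qed

lemma km_eq:
  assumes "m \<ge> 2"
  shows "km m v = rot (pz m) (qz m) (om m * v)"
proof -
  have o: "om m \<noteq> 0" using om_pos[OF assms] by simp
  have "(2 * v) *\<^sub>R lg (Zm m) = (om m * v) *\<^sub>R cm (\<i> * of_real (pz m)) (\<i> * of_real (qz m))"
    using o by (simp add: lg_eq cm_scaleR Zm_def pz_def qz_def complex_eq_iff field_simps)
  then show ?thesis unfolding km_def using mexp_rot[OF pq_unit(1)[OF assms]] by simp
qed

lemma bm_eq:
  assumes "m \<ge> 2"
  shows "bm m v = rot (py m) (qy m) (real m * (om m * v))"
proof -
  have o: "om m \<noteq> 0" "real m \<noteq> 0" using om_pos[OF assms] assms by auto
  have "(2 * v) *\<^sub>R lg (Ym m) = (real m * (om m * v)) *\<^sub>R cm (\<i> * of_real (py m)) (\<i> * of_real (qy m))"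
    using o by (simp add: lg_eq cm_scaleR Ym_def py_def qy_def complex_eq_iff field_simps)
  then show ?thesis unfolding bm_def using mexp_rot[OF pq_unit(2)[OF assms]] by simp
qed

lemma km_in_SU11: "m \<ge> 2 \<Longrightarrow> km m v \<in> SU11"
  by (simp add: km_eq rot_in_SU11 pq_unit)

lemma bm_in_SU11: "m \<ge> 2 \<Longrightarrow> bm m v \<in> SU11"
  by (simp add: bm_eq rot_in_SU11 pq_unit)

section \<open>The factor a(u,w) and polar coordinates on SU(1,1)\<close>

lemma lg_ell: "lg ell = cm (- (\<i> / 2)) (\<i> / 2)"
  by (simp add: lg_eq ell_def)

lemma aa_eq: "aa u w = cm (of_real (cosh w) - \<i> * of_real (u / 2 * exp (- w)))
    (of_real (sinh w) + \<i> * of_real (u / 2 * exp (- w)))"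
proof -
  have nil: "(u *\<^sub>R lg ell) ** (u *\<^sub>R lg ell) = 0"
    by (simp add: lg_ell cm_ops)
  have J: "cm 0 1 ** cm 0 1 = mat 1" by (simp add: cm_ops)
  have "(- 2 * w) *\<^sub>R lg X2 = w *\<^sub>R cm 0 1" by (simp add: lg_eq cm_scaleR)
  then have *: "aa u w = (mat 1 + u *\<^sub>R lg ell) ** (cosh w *\<^sub>R mat 1 + sinh w *\<^sub>R cm 0 1)"
    unfolding aa_def mexp_nilpotent[OF nil] by (simp add: mexp_hyperbolic[OF J])
  have e: "exp (- w) = cosh w - sinh w" by (simp add: cosh_def sinh_def field_simps)
  show ?thesis unfolding * e by (simp add: lg_ell cm_ops field_simps)
qed

text \<open>For q in SU(1,1) this is the first component of q^-1(1,1); the second one is its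
  conjugate.\<close>

definition zc :: "cmat \<Rightarrow> complex" where "zc q = cnj (q $ 1 $ 1) - q $ 1 $ 2"

text \<open>The vector k_m(v)(1,1) runs along an ellipse with half-axes 1 and 3/\<omega>_m,
  clockwise in its first component; rescaling and reflecting the imaginary part makes this the unit
  circle, counterclockwise.\<close>

definition zeta :: "nat \<Rightarrow> cmat \<Rightarrow> complex" where
  "zeta m q = of_real (Re (zc q)) - \<i> * of_real (om m / 3 * Im (zc q))"

text \<open>The normalization is written as a real power of a positive function so that smoothness
  follows from \<open>smooth_on_powr\<close>.\<close>

definition phase :: "nat \<Rightarrow> cmat \<Rightarrow> complex" where
  "phase m q = (Re (zeta m q * cnj (zeta m q)) powr (- 1/2)) *\<^sub>R zeta m q"

lemma zeta_nonzero:
  assumes "m \<ge> 2" "q \<in> SU11"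
  shows "zeta m q \<noteq> 0"
  using assms(2)
proof (rule SU11_cases)
  fix a b assume q: "q = cm a b" "a * cnj a - b * cnj b = 1"
  have "zc q \<noteq> 0"
  proof
    assume "zc q = 0"
    then have "b = cnj a" by (simp add: zc_def q)
    then show False using q(2) by simp
  qed
  then show ?thesis using om_pos[OF assms(1)] by (auto simp: zeta_def complex_eq_iff)
qed

lemma phase_eq: "phase m q = zeta m q / of_real (cmod (zeta m q))"
proof -
  have "Re (zeta m q * cnj (zeta m q)) = (cmod (zeta m q))\<^sup>2"
    by (metis Re_complex_of_real complex_norm_square)
  moreover have "((cmod (zeta m q))\<^sup>2) powr (- 1/2) = inverse (cmod (zeta m q))"
  proof (cases "zeta m q = 0")
    case False
    then have "(cmod (zeta m q))\<^sup>2 = cmod (zeta m q) powr 2" by (simp add: powr_numeral)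
    then show ?thesis using False by (simp add: powr_powr powr_minus)
  qed simp
  ultimately have "phase m q = inverse (cmod (zeta m q)) *\<^sub>R zeta m q" by (simp only: phase_def)
  then show ?thesis by (simp add: scaleR_conv_of_real divide_inverse mult.commute)
qed

text \<open>This is the rule (q r)^-1(1,1) = r^-1 (q^-1(1,1)), with the inverses replaced by
  adjugates.\<close>

lemma zc_mult: "zc (cm a b ** cm c d) = zc (cm a b) * cnj c - cnj (zc (cm a b)) * d"
  by (simp add: zc_def cm_mult algebra_simps)

lemma zc_aa: "zc (aa u w) = of_real (exp (- w))"
proof -
  have "exp (- w) = cosh w - sinh w" by (simp add: cosh_def sinh_def field_simps)
  then show ?thesis by (simp add: zc_def aa_eq)
qed

text \<open>The inverse of a(u,w) scales (1,1) by e^-w, independently of u. Then k_m(v) contributes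
  cos + i (pz + qz) sin, and pz + qz = -3/\<omega>_m is exactly undone by the factor in
  \<open>zeta\<close>.\<close>

lemma zeta_decomposition:
  assumes "m \<ge> 2" "q = aa u w ** matrix_inv (km m v)"
  shows "zeta m q = of_real (exp (- w)) * cis (om m * v)"
proof -
  have "pz m + qz m = - 3 / om m" using om_pos[OF assms(1)] by (simp add: pz_def qz_def field_simps)
  have "matrix_inv (km m v) = rot (pz m) (qz m) (- (om m * v))"
    by (simp add: km_eq[OF assms(1)] rot_inv[OF pq_unit(1)[OF assms(1)]])
  then have q: "q = aa u w ** rot (pz m) (qz m) (- (om m * v))" using assms(2) by simp
  obtain a b where aa: "aa u w = cm a b" using aa_eq by blast
  have z: "zc q = of_real (exp (- w)) * (of_real (cos (om m * v)) + \<i> * of_real ((pz m + qz m) * sin (om m * v)))"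
    unfolding q rot_cm aa zc_mult unfolding aa[symmetric] zc_aa by (simp add: complex_eq_iff algebra_simps)
  show ?thesis using om_pos[OF assms(1)]
    by (simp add: zeta_def z complex_eq_iff \<open>pz m + qz m = - 3 / om m\<close>)
qed

lemma phase_decomposition:
  assumes "m \<ge> 2" "q = aa u w ** matrix_inv (km m v)"
  shows "phase m q = cis (om m * v)"
  unfolding phase_eq zeta_decomposition[OF assms] by (simp add: norm_mult)

text \<open>The modulus of \<open>zeta\<close> gives w. Then q k_m(v) has the same value of
  \<open>zc\<close> as a(u,w), and the elements of SU(1,1) with that value form a line parametrized
  by u.\<close>

lemma decomposition_exists:
  assumes m: "m \<ge> 2" and q: "q \<in> SU11" and v: "phase m q = cis (om m * v)"
  shows "\<exists>u w. q = aa u w ** matrix_inv (km m v)"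
proof -
  define r where "r = cmod (zeta m q)"
  have r: "r > 0" using zeta_nonzero[OF m q] by (simp add: r_def)
  define w where "w = - ln r"
  have ew: "exp (- w) = r" "exp w = inverse r" using r by (simp_all add: w_def exp_minus)
  have pq: "pz m + qz m = - 3 / om m" using om_pos[OF m] by (simp add: pz_def qz_def field_simps)
  have zeta: "zeta m q = of_real r * cis (om m * v)"
    using v r by (simp add: phase_eq r_def field_simps)
  have zc: "zc q = of_real r * (of_real (cos (om m * v)) + \<i> * of_real ((pz m + qz m) * sin (om m * v)))"
    using zeta om_pos[OF m] unfolding pq by (simp add: zeta_def complex_eq_iff field_simps)
  let ?C = "of_real (cos (om m * v)) + \<i> * of_real (pz m * sin (om m * v)) :: complex"
  let ?D = "\<i> * of_real (qz m * sin (om m * v)) :: complex"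
  have k: "km m v = cm ?C ?D" "?C * cnj ?C - ?D * cnj ?D = 1"
    using km_in_SU11[OF m, of v] unfolding km_eq[OF m] rot_cm SU11_cm by simp_all
  have zc': "zc q = of_real r * (?C + ?D)"
    unfolding zc by (simp add: algebra_simps)
  obtain a b where ab: "q = cm a b" "a * cnj a - b * cnj b = 1" using q by (rule SU11_cases)
  obtain c d where cd: "q ** km m v = cm c d" "c * cnj c - d * cnj d = 1"
    using SU11_mult[OF q km_in_SU11[OF m]] by (rule SU11_cases)
  have cd': "c = a * ?C + b * cnj ?D" "d = a * ?D + b * cnj ?C"
    using cd(1) unfolding k(1) ab(1) cm_mult by simp_all
  \<comment> \<open>The left side is \<open>zc\<close> of q k_m(v): right multiplication by k_m(v)
    removes the phase and leaves the modulus r.\<close>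
  have "cnj c - d = zc q * cnj ?C - cnj (zc q) * ?D"
    unfolding cd' by (simp add: zc_def ab algebra_simps)
  also have "\<dots> = of_real r * (?C * cnj ?C - ?D * cnj ?D)"
    unfolding zc' by (simp add: algebra_simps)
  finally have cdr: "cnj c = of_real r + d" unfolding k(2) by (simp add: algebra_simps)
  have c_re: "Re c = r + Re d" "Im c = - Im d" using cdr by (simp_all add: complex_eq_iff)
  have "Re c * Re c + Im c * Im c - (Re d * Re d + Im d * Im d) = 1"
    using cd(2) by (simp add: complex_eq_iff)
  \<comment> \<open>The determinant condition fixes the real part of \<open>d\<close> and leaves its
    imaginary part free.\<close>
  then have "r * r + 2 * r * Re d = 1" unfolding c_re by (simp add: algebra_simps)
  then have red: "Re d = sinh w" "Re c = cosh w"
    using r unfolding sinh_field_def cosh_field_def c_re ew by (simp_all add: field_simps)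
  \<comment> \<open>The value of u is read off from the imaginary part of the upper right entry in
    \<open>aa_eq\<close>.\<close>
  have "q ** km m v = aa (2 * Im d * exp w) w"
    unfolding cd(1) aa_eq by (simp add: complex_eq_iff red c_re(2) ew r order_less_imp_not_eq2 power2_eq_square)
  then have "q = aa (2 * Im d * exp w) w ** matrix_inv (km m v)"
    using SU11_inv_cancel(3)[OF km_in_SU11[OF m]] by metis
  then show ?thesis by blast
qed

section \<open>The map f_m and the field l_m as functions of the phase\<close>

lemma norm_phase: "m \<ge> 2 \<Longrightarrow> q \<in> SU11 \<Longrightarrow> cmod (phase m q) = 1"
  using zeta_nonzero by (simp add: phase_eq norm_divide)

lemma phase_cis:
  assumes "m \<ge> 2" "q \<in> SU11"
  obtains v where "phase m q = cis (om m * v)"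
proof (rule that)
  have "phase m q = cis (Arg (phase m q))"
    using cis_Arg[of "phase m q"] norm_phase[OF assms] by (force simp: sgn_div_norm)
  then show "phase m q = cis (om m * (Arg (phase m q) / om m))" using om_pos[OF assms(1)] by simp
qed

definition kphase :: "nat \<Rightarrow> complex \<Rightarrow> cmat" where
  "kphase m E = cm (of_real (Re E) + \<i> * of_real (pz m * Im E)) (\<i> * of_real (qz m * Im E))"

text \<open>At E = cis(\<omega>_m v), de Moivre makes this the inverse of b_m(v). Since m is an
  integer, only E and not v enters; this removes the ambiguity of v and leaves an expression
  polynomial in the real and imaginary parts of E.\<close>

definition bphase_inv :: "nat \<Rightarrow> complex \<Rightarrow> cmat" where
  "bphase_inv m E = cm (of_real (Re (E ^ m)) - \<i> * of_real (py m * Im (E ^ m))) (- (\<i> * of_real (qy m * Im (E ^ m))))"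

lemma kphase_cis: "m \<ge> 2 \<Longrightarrow> km m v = kphase m (cis (om m * v))"
  by (simp add: km_eq kphase_def rot_cm)

lemma bphase_cis: "m \<ge> 2 \<Longrightarrow> matrix_inv (bm m v) = bphase_inv m (cis (om m * v))"
  unfolding bphase_inv_def Complex.DeMoivre by (simp add: bm_eq rot_inv pq_unit) (simp add: rot_cm)

text \<open>All decompositions of q share the same phase, and both factors depend on v only through
  it, so the description in \<open>fm_def\<close> denotes a unique matrix.\<close>

lemma fm_eq:
  assumes m: "m \<ge> 2" and q: "q \<in> SU11"
  shows "fm m q = kphase m (phase m q) ** bphase_inv m (phase m q)"
  unfolding fm_def
proof (rule the_equality)
  obtain v where v: "phase m q = cis (om m * v)" using phase_cis[OF m q] .
  obtain u w where "q = aa u w ** matrix_inv (km m v)" using decomposition_exists[OF m q v] by blast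
  then show "\<exists>u w v. q = aa u w ** matrix_inv (km m v) \<and>
      kphase m (phase m q) ** bphase_inv m (phase m q) = km m v ** matrix_inv (bm m v)"
    using v kphase_cis[OF m] bphase_cis[OF m] by metis
  fix F assume "\<exists>u w v. q = aa u w ** matrix_inv (km m v) \<and> F = km m v ** matrix_inv (bm m v)"
  then obtain u w v where "q = aa u w ** matrix_inv (km m v)" "F = km m v ** matrix_inv (bm m v)" by blast
  then show "F = kphase m (phase m q) ** bphase_inv m (phase m q)"
    using phase_decomposition[OF m] kphase_cis[OF m] bphase_cis[OF m] by metis
qed

lemma fm_cis:
  assumes "m \<ge> 2" "q \<in> SU11" "phase m q = cis (om m * v)"
  shows "fm m q = km m v ** matrix_inv (bm m v)"
  by (simp add: fm_eq assms kphase_cis bphase_cis)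

lemma fm_in_SU11:
  assumes "m \<ge> 2" "q \<in> SU11"
  shows "fm m q \<in> SU11"
proof (rule phase_cis[OF assms])
  fix v assume "phase m q = cis (om m * v)"
  then show ?thesis
    using fm_cis[OF assms] SU11_mult km_in_SU11 bm_in_SU11 SU11_inv(1) assms(1) by metis
qed

text \<open>The first component of \<open>k\<^sub>m(1,1)\<close>. Since \<open>l\<^sub>g(\<ell>) = - (i/2) (1,1) (1,1)\<^sup>\<dagger> \<gamma>\<^sub>0\<close>, conjugation
  by \<open>k\<^sub>m\<close> replaces \<open>(1,1)\<close> by \<open>k\<^sub>m(1,1)\<close>, which gives the formula for \<open>lgL\<close>.\<close>

definition pvec :: "nat \<Rightarrow> cmat \<Rightarrow> complex" where
  "pvec m q = of_real (Re (phase m q)) - \<i> * of_real (3 / om m * Im (phase m q))"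

definition lgL :: "nat \<Rightarrow> cmat \<Rightarrow> cmat" where
  "lgL m q = cm (- (\<i> * of_real (Re (pvec m q * cnj (pvec m q)) / 2))) (\<i> * (pvec m q * pvec m q) / 2)"

text \<open>Conjugation preserves su(1,1), which provides a vector as required by
  \<open>lam\<close>; injectivity of \<open>lg\<close> makes it unique.\<close>

lemma lg_lam:
  assumes "h \<in> SU11"
  shows "lg (lam h X) = h ** lg X ** matrix_inv h"
proof -
  define Y where "Y = inv lg (h ** lg X ** matrix_inv h)"
  have Y: "lg Y = h ** lg X ** matrix_inv h"
    unfolding Y_def by (rule lg_inv_lg[OF su11_conj[OF assms lg_in_su11]])
  then have "lg Y ** h = h ** lg X" using SU11_inv_cancel(4)[OF assms] by simp
  then have "gam Y ** h = h ** gam X" by (rule gam_commute)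
  then have gY: "gam Y = h ** gam X ** matrix_inv h" using SU11_inv_cancel(3)[OF assms] by metis
  have "lam h X = Y"
    unfolding lam_def
  proof (rule the_equality, rule gY)
    fix Z assume "gam Z = h ** gam X ** matrix_inv h"
    then have "lg Z = lg Y" using gY by (simp add: lg_def)
    then show "Z = Y" using inj_lg by (simp add: inj_eq)
  qed
  then show ?thesis using Y by simp
qed

lemma lg_lam_ell:
  assumes m: "m \<ge> 2" and v: "phase m q = cis (om m * v)"
  shows "lg (lam (km m v) ell) = lgL m q"
proof -
  have pq: "pz m + qz m = - 3 / om m" using om_pos[OF m] by (simp add: pz_def qz_def field_simps)
  let ?C = "of_real (cos (om m * v)) + \<i> * of_real (pz m * sin (om m * v)) :: complex"
  let ?D = "\<i> * of_real (qz m * sin (om m * v)) :: complex"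
  have k: "km m v = cm ?C ?D" "?C * cnj ?C - ?D * cnj ?D = 1"
    using km_in_SU11[OF m, of v] unfolding km_eq[OF m] rot_cm SU11_cm by simp_all
  have "?C + ?D = of_real (cos (om m * v)) + \<i> * of_real ((pz m + qz m) * sin (om m * v))"
    by (simp add: algebra_simps)
  then have p: "pvec m q = ?C + ?D" unfolding pq by (simp add: pvec_def v)
  have "lg (lam (km m v) ell) = km m v ** lg ell ** matrix_inv (km m v)"
    by (rule lg_lam[OF km_in_SU11[OF m]])
  also have "\<dots> = cm ?C ?D ** cm (- (\<i> / 2)) (\<i> / 2) ** cm (cnj ?C) (- ?D)"
    unfolding k(1) SU11_inv_cm[OF k(2)] lg_ell by simp
  also have "\<dots> = cm (- (\<i> / 2) * ((?C + ?D) * cnj (?C + ?D))) (\<i> / 2 * ((?C + ?D) * (?C + ?D)))"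
    unfolding cm_mult cm_eq_iff by (simp add: field_simps)
  also have "\<dots> = lgL m q"
    unfolding lgL_def p[symmetric] cm_eq_iff by (simp add: complex_eq_iff)
  finally show ?thesis .
qed

lemma mat1_frames: "q \<in> SU11 \<Longrightarrow> (q, mat 1) \<in> frames"
  by (simp add: frames_def SU11_1)

lemma ellm_eq:
  assumes m: "m \<ge> 2" and q: "q \<in> SU11"
  shows "ellm m q = q ** (2 *\<^sub>R lgL m q)"
  unfolding ellm_def
proof (rule the_equality)
  have V: "frame_vec (q, mat 1) (lam (km m v) ell) = q ** (2 *\<^sub>R lgL m q)"
    if "q = aa u w ** matrix_inv (km m v)" for u w v
    unfolding frame_vec_eq[OF mat1_frames[OF q]]
    by (simp add: lg_lam_ell[OF m phase_decomposition[OF m that]] cmat_mult_scaleR)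
  obtain v where v: "phase m q = cis (om m * v)" using phase_cis[OF m q] .
  obtain u w where "q = aa u w ** matrix_inv (km m v)" using decomposition_exists[OF m q v] by blast
  then show "\<exists>u w v. q = aa u w ** matrix_inv (km m v) \<and>
      q ** (2 *\<^sub>R lgL m q) = frame_vec (q, mat 1) (lam (km m v) ell)"
    using V by metis
  fix F assume "\<exists>u w v. q = aa u w ** matrix_inv (km m v) \<and> F = frame_vec (q, mat 1) (lam (km m v) ell)"
  then show "F = q ** (2 *\<^sub>R lgL m q)" using V by blast
qed

lemma lgL_in_su11: "lgL m q \<in> su11"
  unfolding su11_iff lgL_def
  by (rule exI[of _ "- (Re (pvec m q * cnj (pvec m q)) / 2)"]) (metis mult_minus_right of_real_minus)

section \<open>Smoothness and the derivative of the spinors\<close>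

lemma bounded_linear_cm_left: "bounded_linear (\<lambda>a. cm a 0)"
  by (rule linear_conv_bounded_linear[THEN iffD1], rule linearI) (simp_all add: cm_ops scaleR_conv_of_real[where 'a=complex])

lemma bounded_linear_cm_right: "bounded_linear (\<lambda>b. cm 0 b)"
  by (rule linear_conv_bounded_linear[THEN iffD1], rule linearI) (simp_all add: cm_ops scaleR_conv_of_real[where 'a=complex])

lemma smooth_on_cm:
  assumes "smooth_on S a" "smooth_on S b"
  shows "smooth_on S (\<lambda>x. cm (a x) (b x))"
proof -
  have "smooth_on S (\<lambda>x. cm (a x) 0 + cm 0 (b x))"
    by (intro smooth_on_add smooth_on_linear_compose[OF bounded_linear_cm_left]
        smooth_on_linear_compose[OF bounded_linear_cm_right] assms)
  then show ?thesis by (simp add: cm_add)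
qed

lemma smooth_on_minus: "smooth_on S f \<Longrightarrow> smooth_on S (\<lambda>x. - f x)"
  by (rule smooth_on_linear_compose[OF bounded_linear_minus[OF bounded_linear_ident]])

lemma smooth_on_diff: "smooth_on S f \<Longrightarrow> smooth_on S g \<Longrightarrow> smooth_on S (\<lambda>x. f x - g x)"
  using smooth_on_add[OF _ smooth_on_minus, of S f g] by simp

lemmas smooth_intros = smooth_on_cm smooth_on_add smooth_on_diff smooth_on_minus smooth_on_const
  smooth_on_bilinear[OF bounded_bilinear_mult] smooth_on_bilinear[OF bounded_bilinear_scaleR]
  smooth_on_bilinear[OF bounded_bilinear_cmat_mult] smooth_on_bilinear[OF bounded_bilinear_cmat_vec]
  smooth_on_linear_compose[OF bounded_linear_of_real] smooth_on_linear_compose[OF bounded_linear_Re]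
  smooth_on_linear_compose[OF bounded_linear_Im] smooth_on_linear_compose[OF bounded_linear_cnj]
  smooth_on_linear_compose[OF bounded_linear_dagger] smooth_on_linear_compose[OF bounded_linear_entry]
  smooth_on_linear[OF bounded_linear_ident]

lemma smooth_on_power:
  fixes f :: "'a::euclidean_space \<Rightarrow> complex"
  shows "smooth_on S f \<Longrightarrow> smooth_on S (\<lambda>x. f x ^ n)"
  by (induction n) (simp_all add: smooth_on_const smooth_on_bilinear[OF bounded_bilinear_mult])

lemma smooth_phase:
  assumes "m \<ge> 2"
  shows "smooth_on AdS3 (\<lambda>q. phase m q)"
proof -
  have z: "smooth_on AdS3 (\<lambda>q. zeta m q)"
    unfolding zeta_def zc_def by (intro smooth_intros)
  have pos: "Re (zeta m q * cnj (zeta m q)) > 0" if "q \<in> AdS3" for q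
    using zeta_nonzero[OF assms that] by (simp add: complex_neq_0 power2_eq_square)
  show ?thesis
    unfolding phase_def by (intro smooth_intros z smooth_on_powr pos)
qed

lemma smooth_fm:
  assumes "m \<ge> 2"
  shows "smooth_on AdS3 (\<lambda>q. fm m q)"
proof (rule smooth_on_cong)
  show "smooth_on AdS3 (\<lambda>q. kphase m (phase m q) ** bphase_inv m (phase m q))"
    unfolding kphase_def bphase_inv_def
    by (intro smooth_intros smooth_phase[OF assms] smooth_on_power)
qed (simp add: fm_eq assms)

lemma smooth_pvec: "m \<ge> 2 \<Longrightarrow> smooth_on AdS3 (\<lambda>q. pvec m q)"
  unfolding pvec_def by (intro smooth_intros smooth_phase)

lemma smooth_lgL: "m \<ge> 2 \<Longrightarrow> smooth_on AdS3 (\<lambda>q. lgL m q)"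
  unfolding lgL_def divide_inverse by (intro smooth_intros smooth_pvec)

section \<open>The invariant form on su(1,1) and the derivative of f_m\<close>

definition su11_form :: "cmat \<Rightarrow> cmat \<Rightarrow> real" where
  "su11_form \<xi> \<eta> = Re (\<xi> $ 1 $ 2 * cnj (\<eta> $ 1 $ 2)) - Im (\<xi> $ 1 $ 1) * Im (\<eta> $ 1 $ 1)"

text \<open>Left translation reduces the metric to a fixed form on su(1,1), the polarization of
  minus the determinant.\<close>

lemma ads_metric_eq:
  assumes "q \<in> AdS3" "\<xi> \<in> su11" "\<eta> \<in> su11"
  shows "ads_metric q (q ** \<xi>) (q ** \<eta>) = su11_form \<xi> \<eta>"
  using assms(2,3)
proof (elim su11_cases)
  fix t b s c assume *: "\<xi> = cm (\<i> * of_real t) b" "\<eta> = cm (\<i> * of_real s) c"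
  have h: "(1/2) *\<^sub>R cm (\<i> * of_real r) d = cm (\<i> * of_real (r / 2)) (d / 2)" for r d
    by (simp add: cm_scaleR)
  show ?thesis
    unfolding ads_metric_def SU11_inv_cancel(2)[OF assms(1)] * h mink_inv_lg
    by (simp add: su11_form_def)
qed

lemma su11_form_commute: "su11_form \<xi> \<eta> = su11_form \<eta> \<xi>"
  by (simp add: su11_form_def)

lemma su11_form_add: "su11_form \<xi> (\<eta> + \<eta>') = su11_form \<xi> \<eta> + su11_form \<xi> \<eta>'"
  by (simp add: su11_form_def algebra_simps)

lemma su11_form_scaleR: "su11_form \<xi> (r *\<^sub>R \<eta>) = r * su11_form \<xi> \<eta>"
  by (simp add: su11_form_def algebra_simps)

lemma su11_form_diff: "su11_form \<xi> (\<eta> - \<eta>') = su11_form \<xi> \<eta> - su11_form \<xi> \<eta>'"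
  by (simp add: su11_form_def algebra_simps)

lemma su11_form_lgL_lgL: "su11_form (lgL m q) (lgL m q) = 0"
  by (simp add: su11_form_def lgL_def algebra_simps)

lemma pvec_nonzero:
  assumes "m \<ge> 2" "q \<in> AdS3"
  shows "pvec m q \<noteq> 0"
proof -
  have "phase m q \<noteq> 0" using norm_phase[OF assms] by auto
  then show ?thesis using om_pos[OF assms(1)] by (auto simp: pvec_def complex_eq_iff)
qed

text \<open>The value is half the squared modulus of \<open>pvec\<close>. It shows that
  \<open>lgL\<close> is nonzero and supplies a vector on which N_m does not vanish.\<close>

lemma su11_form_lgL_timelike:
  assumes "m \<ge> 2" "q \<in> AdS3"
  shows "su11_form (lgL m q) (cm \<i> 0) > 0"
  using pvec_nonzero[OF assms] by (simp add: su11_form_def lgL_def complex_neq_0 power2_eq_square)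

lemma rot_commute:
  "cm (\<i> * of_real p) (\<i> * of_real q) ** rot p q t = rot p q t ** cm (\<i> * of_real p) (\<i> * of_real q)"
  by (simp add: rot_def cmat_add_mult cmat_mult_add cmat_scaleR_mult cmat_mult_scaleR)

lemma bounded_linear_zeta: "bounded_linear (zeta m)"
  by (rule linear_conv_bounded_linear[THEN iffD1], rule linearI)
    (simp_all add: zeta_def zc_def complex_eq_iff algebra_simps)

text \<open>The argument of \<open>zeta\<close> is \<omega>_m v and \<open>zeta\<close> is
  real-linear in q, so the left side is dv(q \<xi>). As l_m = 2 q \<open>lgL\<close>, the result is
  one third of the dual form of l_m.\<close>

lemma zeta_derivative:
  assumes m: "m \<ge> 2" and q: "q \<in> AdS3" and \<xi>: "\<xi> \<in> su11"
  shows "Im (zeta m (q ** \<xi>) / zeta m q) / om m = 2 / 3 * su11_form (lgL m q) \<xi>"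
proof -
  obtain t b where x: "\<xi> = cm (\<i> * of_real t) b" using \<xi> by (rule su11_cases)
  obtain a c where ac: "q = cm a c" using q by (rule SU11_cases)
  define r where "r = cmod (zeta m q)"
  have r: "r > 0" using zeta_nonzero[OF m q] by (simp add: r_def)
  have o: "om m > 0" by (rule om_pos[OF m])
  \<comment> \<open>This is q^-1(1,1) = e^-w k_m(v)(1,1) in terms of the phase.\<close>
  have zp: "zc q = of_real r * pvec m q"
  proof -
    have "phase m q = zeta m q / of_real r" by (simp add: phase_eq r_def)
    moreover have "Re (zeta m q) = Re (zc q)" "Im (zeta m q) = - (om m / 3 * Im (zc q))"
      by (simp_all add: zeta_def)
    ultimately have "Re (phase m q) = Re (zc q) / r" "Im (phase m q) = - (om m / 3 * Im (zc q)) / r"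
      by simp_all
    then show ?thesis using r o by (simp add: pvec_def complex_eq_iff)
  qed
  \<comment> \<open>The derivative of q^-1(1,1) in direction q \<xi> is -\<xi> q^-1(1,1); this is
    its first component.\<close>
  have zx: "zc (q ** \<xi>) = - (\<i> * of_real t * zc q) - b * cnj (zc q)"
    unfolding ac x zc_mult by (simp add: algebra_simps)
  have "Im (zeta m (q ** \<xi>) / zeta m q) = Im (zeta m (q ** \<xi>) * cnj (zeta m q)) / r\<^sup>2"
    unfolding r_def by (subst complex_div_cnj) (simp add: Im_divide_of_real)
  also have "Im (zeta m (q ** \<xi>) * cnj (zeta m q)) = - (om m / 3 * Im (zc (q ** \<xi>) * cnj (zc q)))"
    by (simp add: zeta_def algebra_simps)
  also have "Im (zc (q ** \<xi>) * cnj (zc q)) = - (2 * r\<^sup>2 * su11_form (lgL m q) \<xi>)"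
    unfolding zx zp unfolding x by (simp add: su11_form_def lgL_def power2_eq_square field_simps)
  finally show ?thesis using r o by (simp add: field_simps)
qed

lemma fm_derivative:
  assumes m: "m \<ge> 2" and q: "q \<in> AdS3" and \<xi>: "\<xi> \<in> su11"
  shows "frechet_derivative (\<lambda>q. fm m q *v x) (at q within AdS3) (q ** \<xi>) =
    (- (4 / 9) * su11_form (lgL m q) \<xi>) *\<^sub>R (lgL m q *v (fm m q *v x))"
proof -
  have o: "om m > 0" by (rule om_pos[OF m])
  have "q ** \<xi> \<in> tangent q" using \<xi> by (auto simp: tangent_def)
  then obtain c T where c: "open T" "(0::real) \<in> T" "c 0 = q" "\<And>t. t \<in> T \<Longrightarrow> c t \<in> AdS3"
    "(c has_vector_derivative q ** \<xi>) (at 0)" by (rule tangent_curve[OF q]) blast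
  obtain v0 where v0: "phase m q = cis (om m * v0)" using phase_cis[OF m q] .
  define z0 where "z0 = zeta m q"
  \<comment> \<open>A lift of the angle along the curve. The quotient is 1 at t = 0, where
    \<open>Ln\<close> is differentiable; jumps of \<open>Ln\<close> for other t do not affect the
    phase.\<close>
  define v where "v = (\<lambda>t. v0 + Im (Ln (zeta m (c t) / z0)) / om m)"
  have z0: "z0 \<noteq> 0" using zeta_nonzero[OF m q] by (simp add: z0_def)
  have phase: "phase m (c t) = cis (om m * v t)" if "t \<in> T" for t
  proof -
    define x where "x = zeta m (c t) / z0"
    have x: "x \<noteq> 0" using zeta_nonzero[OF m c(4)[OF that]] z0 by (simp add: x_def)
    have "x = of_real (cmod x) * cis (Im (Ln x))"
      using exp_eq_polar[of "Ln x"] x by simp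
    then have "cis (Im (Ln x)) = x / of_real (cmod x)" using x by (simp add: field_simps)
    moreover have "cis (om m * v t) = cis (om m * v0) * cis (Im (Ln x))"
      using o by (simp add: cis_mult v_def x_def algebra_simps)
    ultimately show ?thesis
      using z0 unfolding v0[symmetric] by (simp add: phase_eq z0_def[symmetric] x_def norm_divide)
  qed
  let ?s = "su11_form (lgL m q) \<xi>"
  have v_0: "v 0 = v0" using z0 by (simp add: v_def c(3) z0_def)
  have dv: "(v has_real_derivative 2 / 3 * ?s) (at 0)"
  proof -
    have "((\<lambda>t. zeta m (c t) / z0) has_vector_derivative zeta m (q ** \<xi>) / z0) (at 0)"
      by (intro bounded_linear.has_vector_derivative[OF bounded_linear_divide]
          bounded_linear.has_vector_derivative[OF bounded_linear_zeta] c(5))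
    moreover have "(Ln has_field_derivative 1) (at (zeta m (c 0) / z0))"
      using has_field_derivative_Ln[of 1] z0 by (simp add: c(3) z0_def)
    ultimately have "(Ln \<circ> (\<lambda>t. zeta m (c t) / z0) has_vector_derivative zeta m (q ** \<xi>) / z0 * 1) (at 0)"
      by (rule field_vector_diff_chain_at)
    then have "((\<lambda>t. Im (Ln (zeta m (c t) / z0))) has_vector_derivative Im (zeta m (q ** \<xi>) / z0)) (at 0)"
      using bounded_linear.has_vector_derivative[OF bounded_linear_Im] by (simp add: o_def)
    then have "((\<lambda>t. Im (Ln (zeta m (c t) / z0))) has_real_derivative Im (zeta m (q ** \<xi>) / z0)) (at 0)"
      by (simp add: has_real_derivative_iff_has_vector_derivative)
    then have "(v has_real_derivative Im (zeta m (q ** \<xi>) / z0) / om m) (at 0)"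
      unfolding v_def using DERIV_add[OF DERIV_const DERIV_cdivide] by fastforce
    then show ?thesis unfolding z0_def zeta_derivative[OF m q \<xi>] .
  qed
  let ?Jz = "cm (\<i> * of_real (pz m)) (\<i> * of_real (qz m))"
  let ?Jy = "cm (\<i> * of_real (py m)) (\<i> * of_real (qy m))"
  let ?K = "km m v0" and ?B = "matrix_inv (bm m v0)"
  have K: "km m w = rot (pz m) (qz m) (om m * w)" for w by (rule km_eq[OF m])
  have B: "matrix_inv (bm m w) = rot (py m) (qy m) (- (real m * (om m * w)))" for w
    by (simp add: bm_eq[OF m] rot_inv[OF pq_unit(2)[OF m]])
  have "((\<lambda>t. om m * v t) has_real_derivative om m * (2 / 3 * ?s)) (at 0)"
    by (rule DERIV_cmult[OF dv])
  from rot_has_vector_derivative[OF pq_unit(1)[OF m] this]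
  have dK: "((\<lambda>t. km m (v t)) has_vector_derivative (om m * (2 / 3 * ?s)) *\<^sub>R (?K ** ?Jz)) (at 0)"
    by (simp add: K v_0)
  have "((\<lambda>t. - (real m * (om m * v t))) has_real_derivative - (real m * (om m * (2 / 3 * ?s)))) (at 0)"
    by (intro DERIV_minus DERIV_cmult dv)
  from rot_has_vector_derivative[OF pq_unit(2)[OF m] this]
  have dB: "((\<lambda>t. matrix_inv (bm m (v t))) has_vector_derivative
      (- (real m * (om m * (2 / 3 * ?s)))) *\<^sub>R (?Jy ** ?B)) (at 0)"
    by (simp add: B v_0 rot_commute)
  \<comment> \<open>The two terms are 2 l_g(Z_m) and 2 l_g(Y_m), and Z_m - Y_m = -ell/3.\<close>
  have diff: "om m *\<^sub>R ?Jz - (real m * om m) *\<^sub>R ?Jy = (- (2 / 3)) *\<^sub>R lg ell"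
    using o m by (simp add: lg_ell cm_ops pz_def qz_def py_def qy_def complex_eq_iff field_simps)
  \<comment> \<open>Moving k_m(v) to the right past l_g(ell) turns the derivative into a left
    multiple of f_m.\<close>
  have conj: "?K ** lg ell = lgL m q ** ?K"
    using lg_lam[OF km_in_SU11[OF m]] lg_lam_ell[OF m v0] SU11_inv_cancel(4)[OF km_in_SU11[OF m]] by metis
  have dF: "?K ** ((- (real m * (om m * (2 / 3 * ?s)))) *\<^sub>R (?Jy ** ?B)) + ((om m * (2 / 3 * ?s)) *\<^sub>R (?K ** ?Jz)) ** ?B =
      (- (4 / 9) * ?s) *\<^sub>R (lgL m q ** fm m q)"
  proof -
    have "?K ** ((- (real m * (om m * (2 / 3 * ?s)))) *\<^sub>R (?Jy ** ?B)) + ((om m * (2 / 3 * ?s)) *\<^sub>R (?K ** ?Jz)) ** ?B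
      = (2 / 3 * ?s) *\<^sub>R (?K ** (om m *\<^sub>R ?Jz - (real m * om m) *\<^sub>R ?Jy) ** ?B)"
      by (simp add: cmat_scaleR_mult cmat_mult_scaleR matrix_mul_assoc scaleR_diff_right mult_ac
          bounded_bilinear.diff_left[OF bounded_bilinear_cmat_mult]
          bounded_bilinear.minus_right[OF bounded_bilinear_cmat_mult]
          bounded_bilinear.diff_right[OF bounded_bilinear_cmat_mult])
    also have "\<dots> = (- (4 / 9) * ?s) *\<^sub>R (?K ** lg ell ** ?B)"
      unfolding diff cmat_mult_scaleR cmat_scaleR_mult by simp
    finally show ?thesis
      unfolding conj fm_cis[OF m q v0] by (simp add: matrix_mul_assoc)
  qed
  have "((\<lambda>t. km m (v t) ** matrix_inv (bm m (v t))) has_vector_derivative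
      (- (4 / 9) * ?s) *\<^sub>R (lgL m q ** fm m q)) (at 0)"
    using bounded_bilinear.has_vector_derivative[OF bounded_bilinear_cmat_mult dK dB] unfolding v_0 dF .
  then have D1: "((\<lambda>t. (km m (v t) ** matrix_inv (bm m (v t))) *v x) has_vector_derivative
      ((- (4 / 9) * ?s) *\<^sub>R (lgL m q ** fm m q)) *v x) (at 0)"
    by (rule bounded_linear.has_vector_derivative[OF bounded_bilinear.bounded_linear_left[OF bounded_bilinear_cmat_vec]])
  have "smooth_on AdS3 (\<lambda>q. fm m q *v x)" by (intro smooth_intros smooth_fm[OF m])
  from smooth_on_along_curve[OF this c(1,2,4,5)] have D2: "((\<lambda>t. fm m (c t) *v x) has_vector_derivative
      frechet_derivative (\<lambda>q. fm m q *v x) (at q within AdS3) (q ** \<xi>)) (at 0)"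
    unfolding c(3) .
  have "fm m (c t) *v x = (km m (v t) ** matrix_inv (bm m (v t))) *v x" if "t \<in> T" for t
    using fm_cis[OF m c(4)[OF that] phase[OF that]] by simp
  from has_vector_derivative_eq_on_open[OF D2 D1 c(1,2) this]
  show ?thesis unfolding cmat_scaleR_vec matrix_vector_mul_assoc .
qed

section \<open>Generalized Killing spinors\<close>

lemma tangent_cases:
  assumes "X \<in> tangent q"
  obtains \<xi> where "\<xi> \<in> su11" "X = q ** \<xi>"
  using assms by (auto simp: tangent_def)

lemma tangentI: "\<xi> \<in> su11 \<Longrightarrow> q ** \<xi> \<in> tangent q"
  by (auto simp: tangent_def)

text \<open>Since i \<gamma>(Y) = 2 l_g(Y), Clifford multiplication by i q \<eta> in the frame (q,
  1) is multiplication by the matrix \<eta> itself. The Killing equation becomes an identity in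
  su(1,1).\<close>

lemma clifford_tangent:
  assumes "q \<in> AdS3" "\<eta> \<in> su11"
  shows "spin_scale \<i> (clifford (q ** \<eta>) (spin_class (q, mat 1) v)) = spin_class (q, mat 1) (\<eta> *v v)"
proof -
  define Y where "Y = inv lg ((1/2) *\<^sub>R \<eta>)"
  have lgY: "lg Y = (1/2) *\<^sub>R \<eta>" unfolding Y_def by (rule lg_inv_lg[OF su11_scaleR[OF assms(2)]])
  have V: "q ** \<eta> = frame_vec (q, mat 1) Y"
    by (simp add: frame_vec_eq[OF mat1_frames[OF assms(1)]] lgY cmat_mult_scaleR)
  have "\<eta> = 2 *\<^sub>R lg Y" using lgY by simp
  then have "\<i> *s (gam Y *v v) = \<eta> *v v"
    by (simp add: vec_eq_iff matrix_vector_mult_def lg_def sum_2 algebra_simps scaleR_conv_of_real[where 'a=complex])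
  then show ?thesis
    unfolding V clifford_eq[OF mat1_frames[OF assms(1)]] spin_scale_eq[OF mat1_frames[OF assms(1)]]
    using V by simp
qed

text \<open>The coefficient 4/9 is 1/9 times the two factors 2 in l_m = 2 q
  \<open>lgL\<close>.\<close>

lemma Am_eq:
  assumes "m \<ge> 2" "q \<in> AdS3" "\<xi> \<in> su11"
  shows "Am m q (q ** \<xi>) = q ** ((1/2) *\<^sub>R \<xi> - (4 / 9 * su11_form (lgL m q) \<xi>) *\<^sub>R lgL m q)"
proof -
  have "ads_metric q (ellm m q) (q ** \<xi>) = 2 * su11_form (lgL m q) \<xi>"
    unfolding ellm_eq[OF assms(1,2)] ads_metric_eq[OF assms(2) su11_scaleR[OF lgL_in_su11] assms(3)]
    by (metis su11_form_commute su11_form_scaleR)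
  then show ?thesis
    by (simp add: Am_def ellm_eq[OF assms(1,2)] cmat_mult_scaleR
        bounded_bilinear.diff_right[OF bounded_bilinear_cmat_mult])
qed

lemma su11_diff: "\<xi> \<in> su11 \<Longrightarrow> \<eta> \<in> su11 \<Longrightarrow> \<xi> - \<eta> \<in> su11"
  using su11_add[of \<xi> "(- 1) *\<^sub>R \<eta>"] su11_scaleR[of \<eta> "- 1"] by simp

lemma Am_su11:
  "\<xi> \<in> su11 \<Longrightarrow> (1/2) *\<^sub>R \<xi> - r *\<^sub>R lgL m q \<in> su11"
  by (intro su11_diff su11_scaleR lgL_in_su11)

lemma Am_endomorphism_field:
  assumes m: "m \<ge> 2"
  shows "endomorphism_field (Am m)"
  unfolding endomorphism_field_def
proof (intro conjI ballI allI impI)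
  fix q X assume q: "q \<in> AdS3" and X: "X \<in> tangent q"
  show "Am m q X \<in> tangent q"
    using X by (elim tangent_cases) (simp add: Am_eq[OF m q] tangentI Am_su11)
  show "Am m q (c *\<^sub>R X) = c *\<^sub>R Am m q X" for c :: real
    using X
  proof (elim tangent_cases)
    fix \<xi> assume \<xi>: "\<xi> \<in> su11" "X = q ** \<xi>"
    have "c *\<^sub>R X = q ** (c *\<^sub>R \<xi>)" by (simp add: \<xi> cmat_mult_scaleR)
    then show ?thesis
      by (simp add: \<xi> Am_eq[OF m q] su11_scaleR su11_form_scaleR cmat_mult_scaleR[symmetric] scaleR_diff_right mult_ac)
  qed
  fix Y assume Y: "Y \<in> tangent q"
  show "Am m q (X + Y) = Am m q X + Am m q Y"
    using X Y
  proof (elim tangent_cases)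
    fix \<xi> \<eta> assume \<xi>: "\<xi> \<in> su11" "X = q ** \<xi>" and \<eta>: "\<eta> \<in> su11" "Y = q ** \<eta>"
    have "X + Y = q ** (\<xi> + \<eta>)" by (simp add: \<xi> \<eta> cmat_mult_add)
    then show ?thesis
      by (simp add: \<xi> \<eta> Am_eq[OF m q] su11_add su11_form_add cmat_mult_add[symmetric] algebra_simps)
  qed
next
  fix V assume V: "smooth_vector_field V"
  have Vt: "V q \<in> tangent q" if "q \<in> AdS3" for q using V that by (simp add: smooth_vector_field_def)
  have V': "smooth_on AdS3 (\<lambda>q. V q)" using V by (simp add: smooth_vector_field_def)
  \<comment> \<open>On SU(1,1) this is q^-1 V(q), written without an inverse so that its smoothness
    is immediate.\<close>
  let ?\<eta> = "\<lambda>q. gamma0 ** dagger q ** gamma0 ** V q"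
  have eq: "Am m q (V q) = (1/2) *\<^sub>R V q - (4 / 9 * su11_form (lgL m q) (?\<eta> q)) *\<^sub>R (q ** lgL m q)"
    if q: "q \<in> AdS3" for q
    using Vt[OF q]
  proof (elim tangent_cases)
    fix \<xi> assume \<xi>: "\<xi> \<in> su11" "V q = q ** \<xi>"
    have "?\<eta> q = \<xi>"
      unfolding \<xi>(2) SU11_inv(4)[OF q, symmetric] by (rule SU11_inv_cancel(2)[OF q])
    then show ?thesis
      unfolding \<xi>(2) Am_eq[OF m q \<xi>(1)]
      by (simp add: cmat_mult_scaleR bounded_bilinear.diff_right[OF bounded_bilinear_cmat_mult])
  qed
  show "smooth_vector_field (\<lambda>q. Am m q (V q))"
    unfolding smooth_vector_field_def
  proof
    show "smooth_on AdS3 (\<lambda>q. Am m q (V q))"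
    proof (rule smooth_on_cong)
      show "smooth_on AdS3 (\<lambda>q. (1/2) *\<^sub>R V q - (4 / 9 * su11_form (lgL m q) (?\<eta> q)) *\<^sub>R (q ** lgL m q))"
        unfolding su11_form_def by (intro smooth_intros smooth_lgL[OF m] V')
    qed (simp add: eq)
    show "\<forall>q\<in>AdS3. Am m q (V q) \<in> tangent q"
    proof
      fix q assume q: "q \<in> AdS3"
      show "Am m q (V q) \<in> tangent q"
        using Vt[OF q] by (elim tangent_cases) (simp add: Am_eq[OF m q] tangentI Am_su11)
    qed
  qed
qed

lemma Am_symmetric:
  assumes m: "m \<ge> 2"
  shows "g_symmetric (Am m)"
  unfolding g_symmetric_def
proof (intro ballI)
  fix q X Y assume q: "q \<in> AdS3" and X: "X \<in> tangent q" and Y: "Y \<in> tangent q"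
  obtain \<xi> where \<xi>: "\<xi> \<in> su11" "X = q ** \<xi>" using X by (rule tangent_cases)
  obtain \<eta> where \<eta>: "\<eta> \<in> su11" "Y = q ** \<eta>" using Y by (rule tangent_cases)
  have "ads_metric q (Am m q X) Y =
      1 / 2 * su11_form \<eta> \<xi> - 4 / 9 * su11_form (lgL m q) \<xi> * su11_form \<eta> (lgL m q)"
    by (simp add: \<xi> \<eta> Am_eq[OF m q] ads_metric_eq[OF q Am_su11]
        su11_form_commute[of _ \<eta>] su11_form_diff su11_form_scaleR)
  also have "\<dots> = ads_metric q X (Am m q Y)"
    by (simp add: \<xi> \<eta> Am_eq[OF m q] ads_metric_eq[OF q _ Am_su11] su11_form_diff su11_form_scaleR
        su11_form_commute[of \<xi>])  (simp add: su11_form_commute[of \<eta> "lgL m q"])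
  finally show "ads_metric q (Am m q X) Y = ads_metric q X (Am m q Y)" .
qed

lemma psi_represents:
  assumes m: "m \<ge> 2"
  shows "represents (psi m \<epsilon>) (\<lambda>q. (q, mat 1)) (\<lambda>q. fm m q *v unit_vec \<epsilon>)"
  unfolding represents_def
proof (intro conjI)
  have "(\<lambda>q::cmat. (q, mat 1 :: cmat)) = (\<lambda>q. (q, 0) + (0, mat 1))" by simp
  moreover have "smooth_on AdS3 (\<lambda>q::cmat. (q, 0 :: cmat) + (0, mat 1))"
    by (intro smooth_on_add smooth_on_const smooth_on_linear bounded_linear_Pair bounded_linear_ident bounded_linear_zero)
  ultimately show "smooth_frame (\<lambda>q. (q, mat 1))"
    by (simp add: smooth_frame_def mat1_frames frame_proj_def)
  show "smooth_on AdS3 (\<lambda>q. fm m q *v unit_vec \<epsilon>)" by (intro smooth_intros smooth_fm[OF m])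
qed (simp add: psi_def)

lemma psi_norm:
  assumes m: "m \<ge> 2" and q: "q \<in> AdS3" and \<epsilon>: "\<epsilon> \<in> {1, -1}"
  shows "(\<Sum>i\<in>UNIV. cnj ((fm m q *v unit_vec \<epsilon>) $ i) * (gamma0 *v (fm m q *v unit_vec \<epsilon>)) $ i) = of_real \<epsilon>"
  unfolding SU11_preserves_form[OF fm_in_SU11[OF m q]]
  using \<epsilon> by (auto simp: unit_vec_def gamma0_def sum_2 matrix_vector_mult_def)

lemma psi_unit:
  assumes m: "m \<ge> 2" and \<epsilon>: "\<epsilon> \<in> {1, -1}"
  shows "unit_spinor_field \<epsilon> (psi m \<epsilon>)"
  unfolding unit_spinor_field_def
proof
  show "spinor_field (psi m \<epsilon>)" unfolding spinor_field_def using psi_represents[OF m] by blast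
  show "\<forall>q\<in>AdS3. spin_inner (psi m \<epsilon> q) (psi m \<epsilon> q) = complex_of_real \<epsilon>"
    unfolding psi_def by (simp add: spin_inner_eq mat1_frames psi_norm[OF m _ \<epsilon>])
qed

text \<open>The summand with 1/2 is the spin connection, and the rank-one summand is the derivative
  of f_m.\<close>

lemma nabla_psi:
  assumes m: "m \<ge> 2" and q: "q \<in> AdS3" and \<xi>: "\<xi> \<in> su11"
  shows "nabla (psi m \<epsilon>) q (q ** \<xi>) =
    spin_class (q, mat 1) (((1/2) *\<^sub>R \<xi> - (4 / 9 * su11_form (lgL m q) \<xi>) *\<^sub>R lgL m q) *v (fm m q *v unit_vec \<epsilon>))"
  unfolding nabla_eq[OF psi_represents[OF m] q tangentI[OF \<xi>]] fm_derivative[OF m q \<xi>] SU11_inv_cancel(2)[OF q]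
  by (simp add: bounded_bilinear.diff_left[OF bounded_bilinear_cmat_vec] cmat_scaleR_vec)

lemma psi_killing:
  assumes m: "m \<ge> 2"
  shows "killing_endomorphism (psi m \<epsilon>) (Am m)"
  unfolding killing_endomorphism_def
proof (intro conjI ballI Am_endomorphism_field[OF m])
  fix q X assume q: "q \<in> AdS3" and X: "X \<in> tangent q"
  show "nabla (psi m \<epsilon>) q X = spin_scale \<i> (clifford (Am m q X) (psi m \<epsilon> q))"
    using X
  proof (rule tangent_cases)
    fix \<xi> assume \<xi>: "\<xi> \<in> su11" "X = q ** \<xi>"
    show ?thesis
      unfolding \<xi>(2) nabla_psi[OF m q \<xi>(1)] Am_eq[OF m q \<xi>(1)] psi_def clifford_tangent[OF q Am_su11[OF \<xi>(1)]] ..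
  qed
qed

text \<open>A spinor of nonzero length is annihilated by no nonzero element of su(1,1); this makes
  the endomorphism of a unit spinor unique.\<close>

lemma su11_mult_nonnull_spinor:
  assumes "\<xi> \<in> su11" "\<xi> *v v = 0" "(\<Sum>i\<in>UNIV. cnj (v $ i) * (gamma0 *v v) $ i) \<noteq> 0"
  shows "\<xi> = 0"
  using assms(1)
proof (rule su11_cases)
  fix t b assume x: "\<xi> = cm (\<i> * of_real t) b"
  have 1: "\<i> * of_real t * v $ 1 + b * v $ 2 = 0" "cnj b * v $ 1 - \<i> * of_real t * v $ 2 = 0"
    using assms(2) unfolding x by (simp_all add: vec_eq_iff forall_2 matrix_vector_mult_def sum_2)
  have n: "cnj (v $ 1) * v $ 1 - cnj (v $ 2) * v $ 2 \<noteq> 0"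
    using assms(3) by (simp add: sum_2 matrix_vector_mult_def gamma0_def)
  \<comment> \<open>Conjugating the second equation yields two equations linear in \<open>b\<close>
    and \<open>t\<close>; eliminating \<open>b\<close> leaves t times the length of
    \<open>v\<close>.\<close>
  have "cnj (cnj b * v $ 1 - \<i> * of_real t * v $ 2) = 0" using 1(2) by simp
  then have 2: "b * cnj (v $ 1) + \<i> * of_real t * cnj (v $ 2) = 0" by simp
  have "\<i> * of_real t * (cnj (v $ 1) * v $ 1 - cnj (v $ 2) * v $ 2) = 0"
    using 1(1) 2 by algebra
  then have t: "t = 0" using n by simp
  then have "b * v $ 2 = 0" "b * cnj (v $ 1) = 0" using 1(1) 2 by simp_all
  then have "b = 0" using n by auto
  then show "\<xi> = 0" using x t by (simp add: cm_0)
qed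

lemma psi_killing_unique:
  assumes m: "m \<ge> 2" and \<epsilon>: "\<epsilon> \<in> {1, -1}" and B: "killing_endomorphism (psi m \<epsilon>) B"
    and q: "q \<in> AdS3" and X: "X \<in> tangent q"
  shows "B q X = Am m q X"
proof -
  have "B q X \<in> tangent q" "Am m q X \<in> tangent q"
    using B psi_killing[OF m] q X unfolding killing_endomorphism_def endomorphism_field_def by blast+
  then obtain \<xi> \<eta> where \<xi>: "\<xi> \<in> su11" "B q X = q ** \<xi>" and \<eta>: "\<eta> \<in> su11" "Am m q X = q ** \<eta>"
    by (metis tangent_cases)
  have "nabla (psi m \<epsilon>) q X = spin_scale \<i> (clifford (B q X) (psi m \<epsilon> q))"
    "nabla (psi m \<epsilon>) q X = spin_scale \<i> (clifford (Am m q X) (psi m \<epsilon> q))"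
    using B psi_killing[OF m] q X unfolding killing_endomorphism_def by blast+
  then have "spin_class (q, mat 1) (\<xi> *v (fm m q *v unit_vec \<epsilon>)) = spin_class (q, mat 1) (\<eta> *v (fm m q *v unit_vec \<epsilon>))"
    unfolding \<xi>(2) \<eta>(2) psi_def clifford_tangent[OF q \<xi>(1)] clifford_tangent[OF q \<eta>(1)] by simp
  then have "\<xi> *v (fm m q *v unit_vec \<epsilon>) = \<eta> *v (fm m q *v unit_vec \<epsilon>)"
    by (rule spin_class_inj[OF mat1_frames[OF q]])
  then have "(\<xi> - \<eta>) *v (fm m q *v unit_vec \<epsilon>) = 0"
    by (simp add: bounded_bilinear.diff_left[OF bounded_bilinear_cmat_vec])
  then have "\<xi> - \<eta> = 0"
    by (rule su11_mult_nonnull_spinor[OF su11_diff[OF \<xi>(1) \<eta>(1)]]) (use psi_norm[OF m q \<epsilon>] \<epsilon> in auto)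
  then show ?thesis using \<xi> \<eta> by simp
qed

section \<open>The nilpotent part of A_m\<close>

lemma Nm_eq:
  assumes "m \<ge> 2" "q \<in> AdS3" "\<xi> \<in> su11"
  shows "Nm m q (q ** \<xi>) = (- (4 / 9) * su11_form (lgL m q) \<xi>) *\<^sub>R (q ** lgL m q)"
  unfolding Nm_def Am_eq[OF assms]
  by (simp add: cmat_mult_scaleR bounded_bilinear.diff_right[OF bounded_bilinear_cmat_mult])

lemma lgL_image_nonzero:
  assumes "m \<ge> 2" "q \<in> AdS3"
  shows "q ** lgL m q \<noteq> 0"
proof
  assume "q ** lgL m q = 0"
  then have "lgL m q = 0"
    using SU11_inv_cancel(2)[OF assms(2)] bounded_bilinear.zero_right[OF bounded_bilinear_cmat_mult] by metis
  then show False using su11_form_lgL_timelike[OF assms] by (simp add: su11_form_def)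
qed

lemma cm_i_su11: "cm \<i> 0 \<in> su11"
  unfolding su11_iff by (rule exI[of _ 1]) simp

lemma Nm_nonzero:
  assumes "m \<ge> 2" "q \<in> AdS3"
  shows "\<exists>X\<in>tangent q. Nm m q X \<noteq> 0"
  by (rule bexI[OF _ tangentI[OF cm_i_su11]])
    (use su11_form_lgL_timelike[OF assms] lgL_image_nonzero[OF assms] in \<open>simp add: Nm_eq[OF assms cm_i_su11]\<close>)

lemma Nm_image:
  assumes "m \<ge> 2" "q \<in> AdS3"
  shows "Nm m q ` tangent q = span {q ** lgL m q}"
proof
  show "Nm m q ` tangent q \<subseteq> span {q ** lgL m q}"
    by (auto elim!: tangent_cases simp: Nm_eq[OF assms] span_base span_scale span_neg)
  show "span {q ** lgL m q} \<subseteq> Nm m q ` tangent q"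
  proof
    fix Y assume "Y \<in> span {q ** lgL m q}"
    then obtain c where c: "Y = c *\<^sub>R (q ** lgL m q)" by (auto simp: span_singleton)
    let ?s = "su11_form (lgL m q) (cm \<i> 0)"
    \<comment> \<open>The coefficient inverts the scalar by which N_m sends q
      \<open>cm \<i> 0\<close> to q \<open>lgL\<close>; it is nonzero by
      \<open>su11_form_lgL_timelike\<close>.\<close>
    have "Y = Nm m q (q ** ((- (9 / 4) * c / ?s) *\<^sub>R cm \<i> 0))"
      unfolding Nm_eq[OF assms su11_scaleR[OF cm_i_su11]] su11_form_scaleR c
      using su11_form_lgL_timelike[OF assms] by simp
    then show "Y \<in> Nm m q ` tangent q" using tangentI[OF su11_scaleR[OF cm_i_su11]] by blast
  qed
qed

lemma Nm_rank:
  assumes "m \<ge> 2" "q \<in> AdS3"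
  shows "dim (Nm m q ` tangent q) = 1"
  unfolding Nm_image[OF assms] dim_span
  using lgL_image_nonzero[OF assms] by (simp add: dim_eq_card_independent)

text \<open>The image of N_m is spanned by l_m, which is null and hence annihilated by pairing with
  itself.\<close>

lemma Nm_square:
  assumes "m \<ge> 2" "q \<in> AdS3" "X \<in> tangent q"
  shows "Nm m q (Nm m q X) = 0"
  using assms(3)
proof (rule tangent_cases)
  fix \<xi> assume \<xi>: "\<xi> \<in> su11" "X = q ** \<xi>"
  show ?thesis
    unfolding \<xi>(2) Nm_eq[OF assms(1,2) \<xi>(1)] cmat_mult_scaleR[symmetric]
    unfolding Nm_eq[OF assms(1,2) su11_scaleR[OF lgL_in_su11]] su11_form_scaleR su11_form_lgL_lgL
    by simp
qed

text \<open>An eigenvector of A_m is one of N_m, and nilpotency makes its image under N_m vanish. A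
  spanning set of eigenvectors would force N_m = 0 on the whole tangent space.\<close>

lemma Am_not_diagonalizable:
  assumes m: "m \<ge> 2" and q: "q \<in> AdS3"
  shows "\<not> diagonalizable_on (tangent q) (Am m q)"
proof
  assume "diagonalizable_on (tangent q) (Am m q)"
  then obtain B where B: "B \<subseteq> tangent q" "span B = tangent q" "\<And>x. x \<in> B \<Longrightarrow> \<exists>c. Am m q x = c *\<^sub>R x"
    unfolding diagonalizable_on_def by blast
  have add: "Nm m q (X + Y) = Nm m q X + Nm m q Y" if "X \<in> tangent q" "Y \<in> tangent q" for X Y
    using Am_endomorphism_field[OF m] q that unfolding endomorphism_field_def Nm_def
    by (simp add: scaleR_add_right)
  have scale: "Nm m q (c *\<^sub>R X) = c *\<^sub>R Nm m q X" if "X \<in> tangent q" for c X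
    using Am_endomorphism_field[OF m] q that unfolding endomorphism_field_def Nm_def
    by (simp add: scaleR_diff_right)
  have eigen: "Nm m q x = 0" if xB: "x \<in> B" for x
  proof -
    obtain c where "Am m q x = c *\<^sub>R x" using B(3)[OF xB] by blast
    then have N: "Nm m q x = (c - 1/2) *\<^sub>R x" by (simp add: Nm_def scaleR_diff_left)
    have x: "x \<in> tangent q" using B(1) xB by blast
    \<comment> \<open>The square of the shifted eigenvalue kills \<open>x\<close>, so either that
      eigenvalue or \<open>x\<close> is zero, and N_m x = 0 in both cases.\<close>
    have "(c - 1/2) *\<^sub>R ((c - 1/2) *\<^sub>R x) = 0"
      using Nm_square[OF m q x] unfolding N scale[OF x] .
    then show ?thesis unfolding N by auto
  qed
  have "x \<in> tangent q \<and> Nm m q x = 0" if "x \<in> span B" for x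
    using that
  proof (induction rule: span_induct_alt)
    case base
    have "0 \<in> tangent q" using B(2) span_zero by metis
    with scale[OF this, of 0] show ?case by simp
  next
    case (step c x y)
    have "x \<in> tangent q" using step B(1) by blast
    moreover have "c *\<^sub>R x \<in> tangent q" using step B(2) by (metis span_base span_scale)
    moreover have "c *\<^sub>R x + y \<in> tangent q" using step B(2) calculation(2) by (metis span_add)
    ultimately show ?case using add scale step eigen by simp
  qed
  then show False using B(2) Nm_nonzero[OF m q] by blast
qed

theorem theorem3p4:
  fixes m :: nat
  assumes "m \<ge> 2"
  shows "(\<forall>\<epsilon>\<in>{1, -1::real}. generalized_Killing_spinor \<epsilon> (psi m \<epsilon>)) \<and>
    g_symmetric (Am m) \<and>
    (\<forall>\<epsilon>\<in>{1, -1::real}. killing_endomorphism (psi m \<epsilon>) (Am m)) \<and>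
    (\<forall>q\<in>AdS3. (\<exists>X\<in>tangent q. Nm m q X \<noteq> 0) \<and>
       dim (Nm m q ` tangent q) = 1 \<and>
       (\<forall>X\<in>tangent q. Nm m q (Nm m q X) = 0)) \<and>
    (\<forall>q\<in>AdS3. \<not> diagonalizable_on (tangent q) (Am m q))"
proof (intro conjI ballI)
  fix \<epsilon> :: real assume \<epsilon>: "\<epsilon> \<in> {1, -1}"
  show "generalized_Killing_spinor \<epsilon> (psi m \<epsilon>)"
    unfolding generalized_Killing_spinor_def
    using psi_unit[OF assms \<epsilon>] psi_killing[OF assms] psi_killing_unique[OF assms \<epsilon>] Am_symmetric[OF assms]
    by blast
qed (simp_all add: assms Am_symmetric psi_killing Nm_nonzero Nm_rank Nm_square Am_not_diagonalizable)

end
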